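(* Let $A=\operatorname{Re}m_\infty(i)$, $B=-\operatorname{Im}m_\infty(i)$, $m=m_\infty(-0)$, and assume that $\operatorname{Re}m_\infty(i)\ne m_\infty(-0)$. Among all Schrödinger L-systems $\Theta_{\mu,h}$ ($\operatorname{Im}h>0$, $\mu\in\mathbb R\cup\{\infty\}$) whose main operator $T_h$ is extremal accretive, an L-system $\Theta_{\mu,h}$ has the maximum finite c-entropy $\mathcal S_{max}$ if and only if it is determined by the parameters $$h=-m+i\sqrt{(A-m)^2+B^2}\quad\text{and (arbitrary)}\quad\mu\in\mathbb R\cup\{\infty\}.$$ In this case, $$\mathcal S_{max}=-\frac12\ln\left(\frac{\sqrt{A^2+B^2-2mA+m^2}-B}{\sqrt{A^2+B^2-2mA+m^2}+B}\right).$$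
   Context: Setting. Let $\ell\in\mathbb R$, let $q$ be a (fixed) real locally summable function on $[\ell,+\infty)$, $l(y)=-y''+q(x)y$, $\mathcal H=L_2(\ell,+\infty)$. Let $D^*$ be the set of $y\in\mathcal H$ that are locally absolutely continuous together with $y'$ and satisfy $l(y)\in\mathcal H$. The minimal symmetric operator $\dot A y=l(y)$ with boundary conditions $y(\ell)=y'(\ell)=0$ is assumed to have deficiency indices $(1,1)$; $\operatorname{Dom}(\dot A^* )=D^*$, $\dot A^*y=l(y)$. For $h\in\mathbb C$ with $\operatorname{Im}h>0$, $T_h y=l(y)$ with domain $\{y\in D^*: y'(\ell)=hy(\ell)\}$. Weyl function. Let $\varphi_1,\varphi_2$ solve $l(\varphi_k)=\lambda\varphi_k$ with $\varphi_1(\ell,\lambda)=0,\varphi_1'(\ell,\lambda)=1$, $\varphi_2(\ell,\lambda)=-1,\varphi_2'(\ell,\lambda)=0$. The Weyl function $m_\infty(\lambda)$ is such that $\varphi_2(\cdot,\lambda)+m_\infty(\lambda)\varphi_1(\cdot,\lambda)\in L_2(\ell,+\infty)$. One has $\operatorname{Im}m_\infty(i)<0$. Standing assumptions: $\dot A$ is nonnegative, $(\dot Af,f)\ge0$ for $f\in\operatorname{Dom}(\dot A)$, and $m_\infty(-0):=\lim_{\lambda\to0,\lambda<0}m_\infty(\lambda)<\infty$. Schrödinger L-systems. $\mathcal H_+=D^*$ with $(y,z)_+=\int_\ell^\infty (y\bar z+l(y)\overline{l(z)})dx$, and $\mathcal H_+\subset\mathcal H\subset\mathcal H_-$ is the corresponding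 rigged triplet; $\delta(x-\ell),\delta'(x-\ell)\in\mathcal H_-$ act by $(y,\delta)=y(\ell)$, $(y,\delta')=-y'(\ell)$. For $\mu\in\mathbb R\cup\{\infty\}$ put $\mathbb A_{\mu,h}y=-y''+q y-\frac1{\mu-h}[y'(\ell)-hy(\ell)][\mu\delta(x-\ell)+\delta'(x-\ell)]$ and $g=\frac{(\operatorname{Im}h)^{1/2}}{|\mu-h|}[\mu\delta(x-\ell)+\delta'(x-\ell)]$ (limits as $\mu\to\infty$ if $\mu=\infty$), $Kc=cg$ for $c\in\mathbb C$; then $\operatorname{Im}\mathbb A_{\mu,h}=KK^*$. The array $\Theta_{\mu,h}=(\mathbb A_{\mu,h},K,1;\ \mathcal H_+\subset\mathcal H\subset\mathcal H_-,\mathbb C)$ is the Schrödinger L-system with main operator $T_h$ and state-space operator $\mathbb A_{\mu,h}$. Its transfer function is $W_{\Theta_{\mu,h}}(z)=I-2iK^*(\mathbb A_{\mu,h}-zI)^{-1}K=\frac{\mu-h}{\mu-\bar h}\cdot\frac{m_\infty(z)+\bar h}{m_\infty(z)+h}$ (limit as $\mu\to\infty$ if $\mu=\infty$). The c-entropy of $\Theta_{\mu,h}$ is $\mathcal S=-\ln|W_{\Theta_{\mu,h}}(-i)|$; it equals $-\ln|\kappa|$ where $|\kappa|=\left|\frac{m_\infty(i)+h}{m_\infty(i)+\bar h}\right|<1$ is the modulus of von Neumann's parameter of $T_h$. Accretivity. A linear operator $T$ is accretive if $\operatorname{Re}(Tf,f)\ge0$ for all $f\in\operatorname{Dom}(T)$;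 it is $\alpha$-sectorial, $\alpha\in(0,\pi/2)$, if $(\cot\alpha)|\operatorname{Im}(Tf,f)|\le\operatorname{Re}(Tf,f)$ for all $f\in\operatorname{Dom}(T)$; an accretive operator is extremal (extremal accretive) if it is not $\alpha$-sectorial for any $\alpha\in(0,\pi/2)$. *)

theory Defs
  imports "HOL-Analysis.Analysis" "HOL-Library.Function_Algebras"
begin

section \<open>The differential expression on the half-line\<close>

text \<open>
  Functions on \<open>[a, \<infinity>)\<close> are total functions \<open>real \<Rightarrow> complex\<close>. Elements of the maximal domain
  are continuous on \<open>[a, \<infinity>)\<close> and are normalised to be \<open>0\<close> to the left of \<open>a\<close>, so that equality
  of HOL functions is equality in \<open>L\<^sub>2(a, \<infinity>)\<close>.
\<close>

definition L2 :: "real \<Rightarrow> (real \<Rightarrow> complex) set" where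
  "L2 a = {f. set_borel_measurable lebesgue {a..} f \<and>
              (\<lambda>x. (cmod (f x))\<^sup>2) absolutely_integrable_on {a..}}"

definition ip :: "real \<Rightarrow> (real \<Rightarrow> complex) \<Rightarrow> (real \<Rightarrow> complex) \<Rightarrow> complex" where
  "ip a f g = (LINT x:{a..}|lebesgue. f x * cnj (g x))"

definition locally_summable :: "real \<Rightarrow> (real \<Rightarrow> 'b::euclidean_space) \<Rightarrow> bool" where
  "locally_summable a f \<longleftrightarrow> (\<forall>b\<ge>a. f absolutely_integrable_on {a..b})"

text \<open>Local absolute continuity means being an indefinite Lebesgue integral; the density is the
  almost everywhere defined derivative.\<close>

definition ac_derivative :: "real \<Rightarrow> (real \<Rightarrow> complex) \<Rightarrow> (real \<Rightarrow> complex) \<Rightarrow> bool" where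
  "ac_derivative a f g \<longleftrightarrow> locally_summable a g \<and> (\<forall>x\<ge>a. f x = f a + integral {a..x} g)"

definition locally_ac :: "real \<Rightarrow> (real \<Rightarrow> complex) \<Rightarrow> bool" where
  "locally_ac a f \<longleftrightarrow> (\<exists>g. ac_derivative a f g)"

definition D1 :: "real \<Rightarrow> (real \<Rightarrow> complex) \<Rightarrow> real \<Rightarrow> complex" where
  "D1 a y x = vector_derivative y (at x within {a..})"

text \<open>A representative of the class modulo null sets of \<open>y''\<close>. All uses below (membership in
  \<open>L\<^sub>2\<close>, integrals, almost everywhere identities) are independent of the choice.\<close>

definition D2 :: "real \<Rightarrow> (real \<Rightarrow> complex) \<Rightarrow> real \<Rightarrow> complex" where
  "D2 a y = (SOME g. ac_derivative a (D1 a y) g)"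

definition regular :: "real \<Rightarrow> (real \<Rightarrow> complex) \<Rightarrow> bool" where
  "regular a y \<longleftrightarrow> locally_ac a y \<and> (\<forall>x\<ge>a. y differentiable (at x within {a..})) \<and>
                  locally_ac a (D1 a y)"

definition schr :: "(real \<Rightarrow> real) \<Rightarrow> real \<Rightarrow> (real \<Rightarrow> complex) \<Rightarrow> real \<Rightarrow> complex" where
  "schr q a y x = - D2 a y x + complex_of_real (q x) * y x"

definition solves :: "(real \<Rightarrow> real) \<Rightarrow> real \<Rightarrow> complex \<Rightarrow> (real \<Rightarrow> complex) \<Rightarrow> bool" where
  "solves q a z y \<longleftrightarrow> regular a y \<and> (AE x\<in>{a..} in lebesgue. schr q a y x = z * y x)"

section \<open>Operators\<close>

definition Dstar :: "(real \<Rightarrow> real) \<Rightarrow> real \<Rightarrow> (real \<Rightarrow> complex) set" where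
  "Dstar q a = {y. (\<forall>x<a. y x = 0) \<and> y \<in> L2 a \<and> regular a y \<and> schr q a y \<in> L2 a}"

definition Dmin :: "(real \<Rightarrow> real) \<Rightarrow> real \<Rightarrow> (real \<Rightarrow> complex) set" where
  "Dmin q a = {y \<in> Dstar q a. y a = 0 \<and> D1 a y a = 0}"

definition dom_T :: "(real \<Rightarrow> real) \<Rightarrow> real \<Rightarrow> complex \<Rightarrow> (real \<Rightarrow> complex) set" where
  "dom_T q a h = {y \<in> Dstar q a. D1 a y a = h * y a}"

text \<open>The dimension of the kernel of \<open>A\<^sup>* - z\<close>, where \<open>A\<^sup>*\<close> is \<open>schr q a\<close> on \<open>Dstar q a\<close>.\<close>

definition defect :: "(real \<Rightarrow> real) \<Rightarrow> real \<Rightarrow> complex \<Rightarrow> nat" where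
  "defect q a z = vector_space.dim (\<lambda>c (f :: real \<Rightarrow> complex) x. c * f x)
                    {y \<in> Dstar q a. solves q a z y}"

definition deficiency_indices :: "(real \<Rightarrow> real) \<Rightarrow> real \<Rightarrow> nat \<times> nat" where
  "deficiency_indices q a = (defect q a \<i>, defect q a (- \<i>))"

text \<open>In the next four notions an operator in \<open>L\<^sub>2(a, \<infinity>)\<close> is given by its domain \<open>S\<close> and
  its action \<open>T\<close>.\<close>

definition nonnegative ::
  "real \<Rightarrow> (real \<Rightarrow> complex) set \<Rightarrow> ((real \<Rightarrow> complex) \<Rightarrow> real \<Rightarrow> complex) \<Rightarrow> bool" where
  "nonnegative a S T \<longleftrightarrow> (\<forall>f\<in>S. ip a (T f) f \<in> \<real>\<^sub>\<ge>\<^sub>0)"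

definition accretive ::
  "real \<Rightarrow> (real \<Rightarrow> complex) set \<Rightarrow> ((real \<Rightarrow> complex) \<Rightarrow> real \<Rightarrow> complex) \<Rightarrow> bool" where
  "accretive a S T \<longleftrightarrow> (\<forall>f\<in>S. Re (ip a (T f) f) \<ge> 0)"

definition sectorial ::
  "real \<Rightarrow> real \<Rightarrow> (real \<Rightarrow> complex) set \<Rightarrow> ((real \<Rightarrow> complex) \<Rightarrow> real \<Rightarrow> complex) \<Rightarrow> bool" where
  "sectorial \<alpha> a S T \<longleftrightarrow> (\<forall>f\<in>S. cot \<alpha> * \<bar>Im (ip a (T f) f)\<bar> \<le> Re (ip a (T f) f))"

definition extremal_accretive ::
  "real \<Rightarrow> (real \<Rightarrow> complex) set \<Rightarrow> ((real \<Rightarrow> complex) \<Rightarrow> real \<Rightarrow> complex) \<Rightarrow> bool" where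
  "extremal_accretive a S T \<longleftrightarrow>
     accretive a S T \<and> \<not> (\<exists>\<alpha>. 0 < \<alpha> \<and> \<alpha> < pi / 2 \<and> sectorial \<alpha> a S T)"

section \<open>Schroedinger L-systems\<close>

text \<open>
  With \<open>\<H>\<^sub>+ = Dstar q a\<close>, an element \<open>\<psi>\<close> of \<open>\<H>\<^sub>-\<close> is represented by the antilinear functional
  \<open>w \<mapsto> (\<psi>, w)\<close> on \<open>\<H>\<^sub>+\<close>. This makes the vector space structure of \<open>\<H>\<^sub>-\<close> pointwise, embeds
  \<open>f \<in> \<H>\<close> as \<open>ip a f\<close>, and turns \<open>(y, \<delta>) = y(a)\<close> and \<open>(y, \<delta>') = - y'(a)\<close> into the following
  conjugated formulas.
\<close>

type_synonym minus_elem = "(real \<Rightarrow> complex) \<Rightarrow> complex"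

definition delta :: "real \<Rightarrow> minus_elem" where
  "delta a w = cnj (w a)"

definition delta' :: "real \<Rightarrow> minus_elem" where
  "delta' a w = - cnj (D1 a w a)"

text \<open>The parameter range \<open>\<real> \<union> {\<infinity>}\<close>, with a single point at infinity.\<close>

datatype mu_param = Fin real | Infty

text \<open>The \<open>Infty\<close> cases of the next two definitions are the limits of the finite ones as \<open>t \<rightarrow> \<infinity>\<close>.\<close>

definition state_op ::
  "(real \<Rightarrow> real) \<Rightarrow> real \<Rightarrow> mu_param \<Rightarrow> complex \<Rightarrow> (real \<Rightarrow> complex) \<Rightarrow> minus_elem" where
  "state_op q a \<mu> h y w =
     (case \<mu> of
        Fin t \<Rightarrow> ip a (schr q a y) w
                 - 1 / (complex_of_real t - h) * (D1 a y a - h * y a)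
                   * (complex_of_real t * delta a w + delta' a w)
      | Infty \<Rightarrow> ip a (schr q a y) w - (D1 a y a - h * y a) * delta a w)"

definition channel_vec :: "real \<Rightarrow> mu_param \<Rightarrow> complex \<Rightarrow> minus_elem" where
  "channel_vec a \<mu> h w =
     (case \<mu> of
        Fin t \<Rightarrow> complex_of_real (sqrt (Im h) / cmod (complex_of_real t - h))
                 * (complex_of_real t * delta a w + delta' a w)
      | Infty \<Rightarrow> complex_of_real (sqrt (Im h)) * delta a w)"

definition channel :: "real \<Rightarrow> mu_param \<Rightarrow> complex \<Rightarrow> complex \<Rightarrow> minus_elem" where
  "channel a \<mu> h c w = c * channel_vec a \<mu> h w"

text \<open>The adjoint \<open>K\<^sup>* : \<H>\<^sub>+ \<rightarrow> \<complex>\<close>, determined by \<open>(K c, y) = c * cnj (K\<^sup>* y)\<close>.\<close>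

definition channel_adj :: "real \<Rightarrow> mu_param \<Rightarrow> complex \<Rightarrow> (real \<Rightarrow> complex) \<Rightarrow> complex" where
  "channel_adj a \<mu> h y = cnj (channel a \<mu> h 1 y)"

text \<open>The vector \<open>(\<A>\<^sub>\<mu>\<^sub>,\<^sub>h - z I)\<^sup>-\<^sup>1 \<psi>\<close> of \<open>\<H>\<^sub>+\<close>, for \<open>\<psi> \<in> \<H>\<^sub>-\<close>.\<close>

definition state_resolvent ::
  "(real \<Rightarrow> real) \<Rightarrow> real \<Rightarrow> mu_param \<Rightarrow> complex \<Rightarrow> complex \<Rightarrow> minus_elem \<Rightarrow> real \<Rightarrow> complex" where
  "state_resolvent q a \<mu> h z \<psi> =
     (THE y. y \<in> Dstar q a \<and>
             (\<forall>w\<in>Dstar q a. state_op q a \<mu> h y w - z * ip a y w = \<psi> w))"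

text \<open>Operators on \<open>\<complex>\<close> are identified with their values at \<open>1\<close>.\<close>

definition transfer_function ::
  "(real \<Rightarrow> real) \<Rightarrow> real \<Rightarrow> mu_param \<Rightarrow> complex \<Rightarrow> complex \<Rightarrow> complex" where
  "transfer_function q a \<mu> h z =
     1 - 2 * \<i> * channel_adj a \<mu> h (state_resolvent q a \<mu> h z (channel a \<mu> h 1))"

text \<open>The case distinction makes the entropy infinite, as \<open>- ln 0\<close>, at a zero of the transfer
  function; the real function \<open>ln\<close> has \<open>ln 0 = 0\<close>.\<close>

definition c_entropy :: "(real \<Rightarrow> real) \<Rightarrow> real \<Rightarrow> mu_param \<Rightarrow> complex \<Rightarrow> ereal" where
  "c_entropy q a \<mu> h =
     (if transfer_function q a \<mu> h (- \<i>) = 0 then \<infinity>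
      else ereal (- ln (cmod (transfer_function q a \<mu> h (- \<i>)))))"

text \<open>The pairs \<open>(\<mu>, h)\<close> parametrising the L-systems with extremal accretive main operator.\<close>

definition extremal_systems :: "(real \<Rightarrow> real) \<Rightarrow> real \<Rightarrow> (mu_param \<times> complex) set" where
  "extremal_systems q a =
     {(\<mu>, h). Im h > 0 \<and> extremal_accretive a (dom_T q a h) (schr q a)}"

end

theory Submission
  imports Defs
begin

text \<open>
  Write \<open>l(y) = - y'' + q y\<close> and \<open>d = A - m\<close>. Two facts reduce the theorem to calculus. First, the transfer
  function at \<open>- \<i>\<close> has modulus \<open>|M(\<i>) + h| / |M(\<i>) + cnj h|\<close> (\<open>transfer_function_eq\<close>), so that the entropy
  depends on \<open>h\<close> alone. Second, \<open>T\<^sub>h\<close> is extremal accretive exactly when \<open>Re h = - m\<close>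
  (\<open>extremal_accretive_iff\<close>). For \<open>h = - m + \<i> v\<close> the squared modulus is
  \<open>(d\<^sup>2 + (v - B)\<^sup>2) / (d\<^sup>2 + (v + B)\<^sup>2)\<close>; it is positive because \<open>d \<noteq> 0\<close>, and has a unique minimum over \<open>v > 0\<close>,
  at \<open>v = sqrt (d\<^sup>2 + B\<^sup>2)\<close> (\<open>entropy_ratio_min\<close>).

  Both facts rest on Green's identity on the whole half-line, with boundary terms at \<open>a\<close> only
  (\<open>limit_pointI\<close>). The boundary form \<open>[y, y] = y cnj y' - y' cnj y\<close> is indefinite of signature (1,1) on pairs
  \<open>(y, y')\<close>, and hence satisfies a reverse Cauchy-Schwarz inequality
  \<open>4 (Im y cnj y') (Im f cnj f') \<le> |[f, y]|\<^sup>2\<close>. Deficiency indices (1,1) force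
  the solution \<open>f\<close> of \<open>l(f) = z f\<close> with \<open>f(a) = 0\<close> not to be square integrable, for \<open>z = \<plusminus> \<i>\<close>. Then
  \<open>Im f cnj f'\<close> at \<open>b\<close> is \<open>Im z\<close> times the squared norm of \<open>f\<close> on \<open>[a, b]\<close>, which tends to infinity, whereas
  \<open>|[f, y]|\<^sup>2\<close> is of smaller order. So the limit of \<open>Im [y, y]\<close> at infinity has a nonpositive product with
  \<open>Im z\<close>, for both signs of \<open>Im z\<close>, and is zero; \<open>[y, y]\<close> has no real part, and polarisation gives the identity for two
  different functions.

  For the second fact, take \<open>y\<close> in the domain of \<open>T\<^sub>h\<close> and \<open>t < 0\<close>, and let \<open>y\<^sub>0\<close> be \<open>y\<close> minus the multiple of the
  Weyl solution at \<open>t\<close> with the same value at \<open>a\<close>. Green's identity gives (\<open>form_decomposition\<close>)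
  \<open>Re (l(y), y) = t |y|\<^sup>2 + ((l - t) y\<^sub>0, y\<^sub>0) + Re (h + M(t)) |y(a)|\<^sup>2\<close>, while \<open>Im (l(y), y) = Im h |y(a)|\<^sup>2\<close>.
  The middle term is nonnegative: functions vanishing at \<open>a\<close> are approximated in the energy form by elements of
  the minimal domain, since there are elements of the maximal domain with \<open>u(a) = 0\<close>, \<open>u'(a) = 1\<close> and arbitrarily
  small norm and energy (\<open>small_test_function\<close>). Letting \<open>t\<close> tend to \<open>0\<close> yields
  \<open>Re (l(y), y) \<ge> (Re h + m) |y(a)|\<^sup>2\<close>, and the same test functions show that the constant \<open>Re h + m\<close> is sharp.
  So \<open>T\<^sub>h\<close> is not accretive for \<open>Re h < - m\<close>, sectorial for \<open>Re h > - m\<close>, and accretive without being sectorial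
  for \<open>Re h = - m\<close>.
\<close>

section \<open>Calculus of locally absolutely continuous functions\<close>

text \<open>
  A continuous factor is bounded on compact intervals, and therefore preserves local summability.
\<close>

lemma locally_summable_mult:
  fixes f g :: "real \<Rightarrow> complex"
  assumes f: "continuous_on {a..} f" and g: "locally_summable a g"
  shows "locally_summable a (\<lambda>x. f x * g x)"
  unfolding locally_summable_def
proof (intro allI impI)
  fix b assume "b \<ge> a"
  have c: "continuous_on {a..b} f" by (rule continuous_on_subset[OF f]) auto
  have bil: "bilinear (\<lambda>x y::complex. x * y)"
    by (auto simp: bilinear_def linear_iff algebra_simps)
  have m: "f \<in> borel_measurable (lebesgue_on {a..b})"
    by (rule continuous_imp_measurable_on_sets_lebesgue[OF c]) simp
  have b: "bounded (f ` {a..b})"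
    by (intro compact_imp_bounded compact_continuous_image c compact_Icc)
  show "(\<lambda>x. f x * g x) absolutely_integrable_on {a..b}"
    using absolutely_integrable_bounded_measurable_product[OF bil m _ b]
      g \<open>b \<ge> a\<close> by (simp add: locally_summable_def)
qed

lemma locally_summable_add:
  "locally_summable a f \<Longrightarrow> locally_summable a g \<Longrightarrow> locally_summable a (\<lambda>x. f x + g x)"
  by (simp add: locally_summable_def set_integral_add)

lemma locally_summable_cmult:
  fixes f :: "real \<Rightarrow> complex"
  shows "locally_summable a f \<Longrightarrow> locally_summable a (\<lambda>x. c * f x)"
  by (simp add: locally_summable_def)

lemma locally_summable_cnj:
  "locally_summable a f \<Longrightarrow> locally_summable a (\<lambda>x. cnj (f x))"
  unfolding locally_summable_def
  using absolutely_integrable_linear[where h=cnj, unfolded o_def, OF _ bounded_linear_cnj] by blast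

lemma locally_summable_continuous:
  fixes f :: "real \<Rightarrow> complex"
  assumes "continuous_on {a..} f"
  shows "locally_summable a f"
  unfolding locally_summable_def
  by (intro allI impI absolutely_integrable_continuous_real continuous_on_subset[OF assms]) auto

lemma locally_summable_absolutely_integrable:
  assumes "locally_summable a f" "a \<le> u"
  shows "f absolutely_integrable_on {u..v}"
proof (cases "u \<le> v")
  case True
  then show ?thesis
    using assms by (intro set_integrable_subset[of lebesgue "{a..v}" f "{u..v}"]) (auto simp: locally_summable_def)
qed simp

lemma locally_summable_integrable:
  assumes "locally_summable a f" "a \<le> u"
  shows "f integrable_on {u..v}"
  using locally_summable_absolutely_integrable[OF assms] set_lebesgue_integral_eq_integral(1) by blast

lemma ac_derivative_summable: "ac_derivative a f F \<Longrightarrow> locally_summable a F"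
  by (simp add: ac_derivative_def)

lemma ac_derivative_eq: "ac_derivative a f F \<Longrightarrow> a \<le> x \<Longrightarrow> f x = f a + integral {a..x} F"
  unfolding ac_derivative_def by blast

lemma ac_derivativeI:
  "locally_summable a F \<Longrightarrow> (\<And>x. a \<le> x \<Longrightarrow> f x = f a + integral {a..x} F) \<Longrightarrow> ac_derivative a f F"
  unfolding ac_derivative_def by blast

lemma ac_derivative_increment:
  assumes "ac_derivative a f F" "a \<le> u" "u \<le> v"
  shows "f v - f u = integral {u..v} F"
proof -
  have "integral {a..u} F + integral {u..v} F = integral {a..v} F"
    using assms by (intro Henstock_Kurzweil_Integration.integral_combine
        locally_summable_integrable[where a=a]) (auto dest: ac_derivative_summable)
  then show ?thesis
    using ac_derivative_eq[OF assms(1), of v] ac_derivative_eq[OF assms(1), of u] assms by (simp add: algebra_simps)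
qed

lemma ac_derivative_cong:
  assumes "ac_derivative a f F" and fg: "\<And>x. x \<ge> a \<Longrightarrow> f x = g x" and FG: "\<And>x. x \<ge> a \<Longrightarrow> F x = G x"
  shows "ac_derivative a g G"
proof (rule ac_derivativeI)
  show "locally_summable a G"
    unfolding locally_summable_def
  proof (intro allI impI)
    fix b assume b: "b \<ge> a"
    have "F absolutely_integrable_on {a..b}"
      using locally_summable_absolutely_integrable[OF ac_derivative_summable[OF assms(1)]] by simp
    moreover have "set_integrable lebesgue {a..b} F = set_integrable lebesgue {a..b} G"
      by (rule set_integrable_cong) (use FG in auto)
    ultimately show "G absolutely_integrable_on {a..b}" by blast
  qed
  fix x assume x: "a \<le> x"
  have I: "integral {a..x} F = integral {a..x} G"
    by (rule integral_cong) (use FG in auto)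
  have "g x = f x" by (rule fg[OF x, symmetric])
  also have "\<dots> = f a + integral {a..x} F" by (rule ac_derivative_eq[OF assms(1) x])
  also have "\<dots> = g a + integral {a..x} G" unfolding I using fg[of a] by (metis order_refl)
  finally show "g x = g a + integral {a..x} G" .
qed

lemma at_within_halfline:
  fixes x :: real
  assumes "a \<le> x"
  shows "at x within {a..x+1} = at x within {a..}"
  by (rule at_within_nhd[of _ "{..<x+1}"]) (use assms in auto)

lemma ac_derivative_continuous_on:
  assumes "ac_derivative a f F"
  shows "continuous_on {a..} f"
proof -
  have "continuous_on {a..b} f" for b
  proof (cases "a \<le> b")
    case True
    have "continuous_on {a..b} (\<lambda>x. f a + integral {a..x} F)"
      using assms by (intro continuous_intros indefinite_integral_continuous_1
          locally_summable_integrable[where a=a]) (auto dest: ac_derivative_summable)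
    moreover have "\<And>x. x \<in> {a..b} \<Longrightarrow> f a + integral {a..x} F = f x"
      by (rule ac_derivative_eq[OF assms, symmetric]) simp
    ultimately show ?thesis by (rule continuous_on_eq)
  qed simp
  then have *: "continuous (at x within {a..x+1}) f" if "x \<ge> a" for x
    using that by (auto simp: continuous_on_eq_continuous_within)
  show ?thesis
    unfolding continuous_on_eq_continuous_within
  proof
    fix x assume x: "x \<in> {a..}"
    then show "continuous (at x within {a..}) f" using *[of x] at_within_halfline[of a x] by auto
  qed
qed

lemma ac_derivative_add:
  assumes f: "ac_derivative a f F" and g: "ac_derivative a g G"
  shows "ac_derivative a (\<lambda>x. f x + g x) (\<lambda>x. F x + G x)"
proof (rule ac_derivativeI)
  note s = ac_derivative_summable[OF f] ac_derivative_summable[OF g]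
  show "locally_summable a (\<lambda>x. F x + G x)" using s by (rule locally_summable_add)
  fix x assume x: "a \<le> x"
  have "integral {a..x} (\<lambda>x. F x + G x) = integral {a..x} F + integral {a..x} G"
    using s by (intro Henstock_Kurzweil_Integration.integral_add locally_summable_integrable) auto
  then show "f x + g x = f a + g a + integral {a..x} (\<lambda>x. F x + G x)"
    using ac_derivative_eq[OF f x] ac_derivative_eq[OF g x] by simp
qed

lemma ac_derivative_cmult:
  assumes f: "ac_derivative a f F"
  shows "ac_derivative a (\<lambda>x. c * f x) (\<lambda>x. c * F x)"
proof (rule ac_derivativeI)
  show "locally_summable a (\<lambda>x. c * F x)"
    using ac_derivative_summable[OF f] by (rule locally_summable_cmult)
  fix x assume x: "a \<le> x"
  show "c * f x = c * f a + integral {a..x} (\<lambda>x. c * F x)"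
    by (subst ac_derivative_eq[OF f x]) (simp add: algebra_simps)
qed

lemma ac_derivative_cnj:
  assumes f: "ac_derivative a f F"
  shows "ac_derivative a (\<lambda>x. cnj (f x)) (\<lambda>x. cnj (F x))"
proof (rule ac_derivativeI)
  show "locally_summable a (\<lambda>x. cnj (F x))"
    using ac_derivative_summable[OF f] by (rule locally_summable_cnj)
  fix x assume x: "a \<le> x"
  show "cnj (f x) = cnj (f a) + integral {a..x} (\<lambda>x. cnj (F x))"
    by (subst ac_derivative_eq[OF f x]) (simp add: integral_cnj)
qed

text \<open>
  Allowing finitely many exceptional points serves cut-off functions glued from smooth pieces.
\<close>

lemma ac_derivative_FTC:
  assumes "continuous_on {a..} f" "finite S" "locally_summable a F"
    and "\<And>x. x > a \<Longrightarrow> x \<notin> S \<Longrightarrow> (f has_vector_derivative F x) (at x)"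
  shows "ac_derivative a f F"
proof -
  have *: "(F has_integral f b - f a) {a..b}" if "a \<le> b" for b
    using assms that by (intro fundamental_theorem_of_calculus_interior_strong[of S]
        continuous_on_subset[OF assms(1)]) auto
  show ?thesis
    by (rule ac_derivativeI[OF assms(3)]) (simp add: integral_unique[OF *])
qed

text \<open>
  The defect \<open>E u v\<close> of the product rule on \<open>[u, v]\<close> is additive in the interval, and on an interval where the
  oscillations of \<open>f\<close> and \<open>g\<close> are at most \<open>e\<close> it is at most \<open>e\<close> times the integral of \<open>|F| + |G|\<close>, because it is
  the integral of \<open>F (g(v) - g) + (f(u) - f) G\<close>. Bolzano's bisection principle carries this bound from small
  intervals to \<open>[a, b]\<close>, and \<open>e\<close> is arbitrary.
\<close>

lemma ac_derivative_mult:
  assumes f: "ac_derivative a f F" and g: "ac_derivative a g G"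
  shows "ac_derivative a (\<lambda>x. f x * g x) (\<lambda>x. F x * g x + f x * G x)"
proof -
  note cf = ac_derivative_continuous_on[OF f] and cg = ac_derivative_continuous_on[OF g]
  note sF = ac_derivative_summable[OF f] and sG = ac_derivative_summable[OF g]
  define H where "H = (\<lambda>x. F x * g x + f x * G x)"
  have sH: "locally_summable a H" unfolding H_def
    using locally_summable_mult[OF cg sF] locally_summable_mult[OF cf sG]
    by (intro locally_summable_add) (simp_all add: mult.commute)
  have sV: "locally_summable a (\<lambda>x. cmod (F x) + cmod (G x))"
    using sF sG by (auto simp: locally_summable_def intro!: set_integral_add absolutely_integrable_norm[unfolded o_def])
  define V where "V = (\<lambda>u v. integral {u..v} (\<lambda>x. cmod (F x) + cmod (G x)))"
  have Vadd: "V u v + V v w = V u w" if "a \<le> u" "u \<le> v" "v \<le> w" for u v w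
    unfolding V_def using that by (intro Henstock_Kurzweil_Integration.integral_combine
        locally_summable_integrable[OF sV]) auto
  have Hadd: "integral {u..v} H + integral {v..w} H = integral {u..w} H"
    if "a \<le> u" "u \<le> v" "v \<le> w" for u v w
    using that by (intro Henstock_Kurzweil_Integration.integral_combine
        locally_summable_integrable[OF sH]) auto
  define E where "E = (\<lambda>u v. f v * g v - f u * g u - integral {u..v} H)"
  have "E a b = 0" if ab: "a \<le> b" for b
  proof -
    have *: "cmod (E a b) \<le> e * V a b" if e: "e > 0" for e
    proof -
      define P where "P = (\<lambda>u v. a \<le> u \<and> v \<le> b \<longrightarrow> cmod (E u v) \<le> e * V u v)"
      have "P a b" using ab
      proof (induction rule: Bolzano)
        case (trans u v w)
        show ?case unfolding P_def
        proof
          assume uw: "a \<le> u \<and> w \<le> b"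
          then have 1: "cmod (E u v) \<le> e * V u v" "cmod (E v w) \<le> e * V v w" using trans by (auto simp: P_def)
          have "E u w = E u v + E v w"
            using Hadd[of u v w] trans uw by (auto simp: E_def algebra_simps)
          also have "cmod \<dots> \<le> e * (V u v + V v w)"
            using 1 norm_triangle_ineq[of "E u v" "E v w"] by (simp add: algebra_simps)
          finally show "cmod (E u w) \<le> e * V u w" using Vadd[of u v w] trans uw by simp
        qed
      next
        case (local x)
        have "continuous (at x within {a..}) f" "continuous (at x within {a..}) g"
          using cf cg local by (auto simp: continuous_on_eq_continuous_within)
        then obtain d1 d2 where d: "d1 > 0" "d2 > 0"
          "\<And>s. s \<in> {a..} \<Longrightarrow> dist s x < d1 \<Longrightarrow> dist (f s) (f x) < e/2"
          "\<And>s. s \<in> {a..} \<Longrightarrow> dist s x < d2 \<Longrightarrow> dist (g s) (g x) < e/2"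
          unfolding continuous_within_eps_delta using e half_gt_zero by metis
        show ?case unfolding P_def
        proof (intro exI[of _ "min d1 d2"] conjI allI impI)
          show "min d1 d2 > 0" using d by simp
          fix u v assume uv: "u \<le> x \<and> x \<le> v \<and> v - u < min d1 d2" and "a \<le> u \<and> v \<le> b"
          then have au: "a \<le> u" "u \<le> v" by auto
          have close: "cmod (f u - f s) \<le> e" "cmod (g v - g s) \<le> e" if "s \<in> {u..v}" for s
          proof -
            have "dist s x < d1" "dist s x < d2" "dist u x < d1" "dist v x < d2" "s \<in> {a..}" "u \<in> {a..}" "v \<in> {a..}"
              using that uv au by (auto simp: dist_real_def)
            then have "dist (f u) (f x) < e/2" "dist (f s) (f x) < e/2"
              "dist (g v) (g x) < e/2" "dist (g s) (g x) < e/2" using d by auto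
            then show "cmod (f u - f s) \<le> e" "cmod (g v - g s) \<le> e"
              using dist_triangle_half_l[of "f u" "f x" e "f s"] dist_triangle_half_l[of "g v" "g x" e "g s"]
              by (auto simp: dist_norm norm_minus_commute)
          qed
          define K where "K = (\<lambda>s. (F s * g v + f u * G s) - H s)"
          have iF: "F integrable_on {u..v}" "G integrable_on {u..v}" "H integrable_on {u..v}"
            using locally_summable_integrable au sF sG sH by auto
          have "(K has_integral (integral {u..v} F * g v + f u * integral {u..v} G - integral {u..v} H)) {u..v}"
            unfolding K_def
            by (intro has_integral_diff has_integral_add has_integral_mult_left has_integral_mult_right
                integrable_integral iF)
          note iK = has_integral_integrable[OF this] and K = integral_unique[OF this]
          have "E u v = (f v - f u) * g v + f u * (g v - g u) - integral {u..v} H"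
            by (simp add: E_def algebra_simps)
          also have "\<dots> = integral {u..v} K"
            unfolding ac_derivative_increment[OF f au] ac_derivative_increment[OF g au] K ..
          also have "cmod \<dots> \<le> integral {u..v} (\<lambda>x. e * (cmod (F x) + cmod (G x)))"
          proof (rule integral_norm_bound_integral[OF iK])
            show "(\<lambda>x. e * (cmod (F x) + cmod (G x))) integrable_on {u..v}"
              using locally_summable_integrable[OF sV au(1)] by (intro integrable_on_mult_right)
            fix s assume s: "s \<in> {u..v}"
            have "K s = F s * (g v - g s) + (f u - f s) * G s"
              by (simp add: K_def H_def algebra_simps)
            also have "cmod \<dots> \<le> cmod (F s) * e + e * cmod (G s)"
              using close[OF s] by (intro order_trans[OF norm_triangle_ineq] add_mono)
                (auto simp: norm_mult intro!: mult_left_mono mult_right_mono)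
            finally show "cmod (K s) \<le> e * (cmod (F s) + cmod (G s))" by (simp add: algebra_simps)
          qed
          also have "\<dots> = e * V u v" by (simp add: V_def)
          finally show "cmod (E u v) \<le> e * V u v" .
        qed
      qed
      then show ?thesis by (simp add: P_def)
    qed
    have "cmod (E a b) \<le> 0"
    proof (rule field_le_epsilon)
      fix r :: real assume r: "r > 0"
      define e where "e = r / (\<bar>V a b\<bar> + 1)"
      have "e > 0" using r by (simp add: e_def)
      moreover have "e * V a b \<le> r"
      proof -
        have "e * V a b \<le> e * (\<bar>V a b\<bar> + 1)" using \<open>e > 0\<close> by (intro mult_left_mono) auto
        also have "\<dots> = r" by (simp add: e_def)
        finally show ?thesis .
      qed
      ultimately show "cmod (E a b) \<le> 0 + r" using *[of e] by simp
    qed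
    then show ?thesis by simp
  qed
  then have "f x * g x = f a * g a + integral {a..x} H" if "a \<le> x" for x
    using that unfolding E_def by (metis add.commute diff_diff_eq eq_iff_diff_eq_0)
  then show ?thesis
    unfolding H_def[symmetric] by (rule ac_derivativeI[OF sH])
qed

text \<open>
  The half-lines generate the Borel sets and are closed under intersection, so a Dynkin argument extends the
  vanishing of the integral to all Borel sets.
\<close>

lemma AE_zero_if_lower_integrals_zero:
  fixes g :: "real \<Rightarrow> real"
  assumes g: "integrable lborel g"
    and I: "\<And>t. (LINT x:{..t}|lborel. g x) = 0" and whole: "integral\<^sup>L lborel g = 0"
  shows "AE x in lborel. g x = 0"
proof (rule sigma_finite_measure.density_zero[OF sigma_finite_lborel g])
  fix A :: "real set" assume "A \<in> sets lborel"
  then have "A \<in> sigma_sets UNIV (range (\<lambda>a. {..a::real}))"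
    by (simp add: borel_eq_atMost)
  have sb: "A \<in> sets lborel" if "A \<in> sigma_sets UNIV (range (\<lambda>a. {..a::real}))" for A
    using that by (simp add: borel_eq_atMost)
  have ist: "Int_stable (range (\<lambda>a. {..a::real}))"
    by (auto simp: Int_stable_def)
  have sub: "range (\<lambda>a. {..a::real}) \<subseteq> Pow UNIV" by simp
  have gi: "set_integrable lborel A g" if "A \<in> sets lborel" for A
    using integrable_mult_indicator[OF that g] by (simp add: set_integrable_def)
  show "set_lebesgue_integral lborel A g = 0"
    using ist sub \<open>A \<in> sigma_sets UNIV (range (\<lambda>a. {..a::real}))\<close>
  proof (induction rule: sigma_sets_induct_disjoint)
    case (basic A)
    then show ?case using I by auto
  next
    case empty
    show ?case by (simp add: set_lebesgue_integral_def)
  next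
    case (compl A)
    note A = sb[OF compl(1)]
    have "set_lebesgue_integral lborel (A \<union> (UNIV - A)) g
        = set_lebesgue_integral lborel A g + set_lebesgue_integral lborel (UNIV - A) g"
      by (rule set_integral_Un) (use A in \<open>auto intro!: gi\<close>)
    moreover have "set_lebesgue_integral lborel (A \<union> (UNIV - A)) g = integral\<^sup>L lborel g"
      by (simp add: set_lebesgue_integral_def)
    ultimately show ?case using compl whole by simp
  next
    case (union A)
    have A: "A i \<in> sets lborel" for i using union(2) sb by auto
    have "set_lebesgue_integral lborel (\<Union>i. A i) g = (\<Sum>i. set_lebesgue_integral lborel (A i) g)"
      by (rule lebesgue_integral_countable_add[OF A])
        (use union(1) A in \<open>auto simp: disjoint_family_on_def intro!: gi\<close>)
    then show ?case using union(3) by simp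
  qed
qed

lemma AE_zero_if_indefinite_integral_zero:
  fixes h :: "real \<Rightarrow> real"
  assumes h: "h absolutely_integrable_on {a..b}"
    and I: "\<And>t. a \<le> t \<Longrightarrow> t \<le> b \<Longrightarrow> integral {a..t} h = 0"
  shows "AE x in lebesgue. x \<in> {a..b} \<longrightarrow> h x = 0"
proof (cases "a \<le> b")
  case False
  then show ?thesis by simp
next
  case ab: True
  define k where "k = (\<lambda>x. indicat_real {a..b} x *\<^sub>R h x)"
  have k: "integrable lebesgue k" using h by (simp add: set_integrable_def k_def)
  have "k \<in> borel_measurable (completion lborel)" using k by (rule borel_measurable_integrable)
  then obtain g where g: "g \<in> borel_measurable lborel" "AE x in lborel. k x = g x"
    using completion_ex_borel_measurable_real[of k lborel] by blast
  \<comment> \<open>A Borel representative brings the problem from the completed measure to the Borel sets.\<close>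
  have kg: "AE x in lebesgue. k x = g x" using g(2) by (rule AE_completion)
  have gm: "g \<in> borel_measurable lebesgue" using g(1) by (rule measurable_completion)
  have "integrable lebesgue g"
    using k by (rule integrable_cong_AE_imp[OF _ gm]) (use kg in auto)
  then have gi: "integrable lborel g" using integrable_completion[OF g(1)] by simp
  have hl: "(LINT x:{a..t}|lebesgue. h x) = 0" if "t \<le> b" for t
  proof (cases "a \<le> t")
    case True
    have "h absolutely_integrable_on {a..t}"
      by (rule set_integrable_subset[OF h]) (use that in auto)
    then show ?thesis using I[OF True that] set_lebesgue_integral_eq_integral(2) by metis
  qed (simp add: set_lebesgue_integral_def)
  have S: "(LINT x|lebesgue. indicat_real S x *\<^sub>R k x) = (LINT x|lborel. indicat_real S x *\<^sub>R g x)"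
    if "S \<in> sets lborel" for S
  proof -
    have m: "(\<lambda>x. indicat_real S x *\<^sub>R g x) \<in> borel_measurable lborel"
      using g(1) that by simp
    have "(LINT x|lebesgue. indicat_real S x *\<^sub>R k x) = (LINT x|lebesgue. indicat_real S x *\<^sub>R g x)"
    proof (rule integral_cong_AE)
      show "(\<lambda>x. indicat_real S x *\<^sub>R k x) \<in> borel_measurable lebesgue"
        using k that by (intro borel_measurable_scaleR borel_measurable_indicator) (auto dest: borel_measurable_integrable)
      show "(\<lambda>x. indicat_real S x *\<^sub>R g x) \<in> borel_measurable lebesgue"
        using m by (rule measurable_completion)
    qed (use kg in auto)
    also have "\<dots> = (LINT x|lborel. indicat_real S x *\<^sub>R g x)"
      by (rule integral_completion[OF m])
    finally show ?thesis .
  qed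
  have "AE x in lborel. g x = 0"
  proof (rule AE_zero_if_lower_integrals_zero[OF gi])
    fix t
    have "indicat_real {..t} x *\<^sub>R k x = indicat_real {a..min t b} x *\<^sub>R h x" for x
      by (auto simp: k_def indicator_def)
    then show "(LINT x:{..t}|lborel. g x) = 0"
      using S[of "{..t}"] hl[of "min t b"] by (simp add: set_lebesgue_integral_def)
  next
    show "integral\<^sup>L lborel g = 0"
      using S[of UNIV] hl[of b] by (simp add: set_lebesgue_integral_def k_def)
  qed
  then have "AE x in lebesgue. g x = 0" by (rule AE_completion)
  with kg show ?thesis by eventually_elim (auto simp: k_def)
qed

text \<open>
  Uniqueness of the density is what makes the class of \<open>D2 a y\<close>, and hence the expression \<open>schr q a y\<close> up to
  null sets, linear in \<open>y\<close>.
\<close>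

lemma ac_derivative_unique:
  assumes F: "ac_derivative a f F" and G: "ac_derivative a f G"
  shows "AE x\<in>{a..} in lebesgue. F x = G x"
proof -
  note s = ac_derivative_summable[OF F] ac_derivative_summable[OF G]
  have "AE x in lebesgue. x \<in> {a..a + real n} \<longrightarrow> F x = G x" for n
  proof -
    have ai: "F absolutely_integrable_on {a..a + real n}" "G absolutely_integrable_on {a..a + real n}"
      using s by (auto simp: locally_summable_def)
    then have d: "(\<lambda>x. F x - G x) absolutely_integrable_on {a..a + real n}"
      by (rule set_integral_diff)
    have z: "((\<lambda>x. F x - G x) has_integral 0) {a..t}" if t: "a \<le> t" for t
    proof -
      have i: "F integrable_on {a..t}" "G integrable_on {a..t}"
        using s locally_summable_integrable by auto
      have "integral {a..t} F = integral {a..t} G"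
        using ac_derivative_eq[OF F t] ac_derivative_eq[OF G t] by (metis add_left_cancel)
      then show ?thesis
        using has_integral_diff[OF integrable_integral[OF i(1)] integrable_integral[OF i(2)]] by simp
    qed
    have "AE x in lebesgue. x \<in> {a..a + real n} \<longrightarrow> Re (F x - G x) = 0"
    proof (rule AE_zero_if_indefinite_integral_zero)
      show "(\<lambda>x. Re (F x - G x)) absolutely_integrable_on {a..a + real n}"
        using absolutely_integrable_linear[OF d bounded_linear_Re] by (simp add: o_def)
      fix t assume "a \<le> t"
      from has_integral_linear[OF z[OF this] bounded_linear_Re]
      show "integral {a..t} (\<lambda>x. Re (F x - G x)) = 0" by (intro integral_unique) (simp add: o_def)
    qed
    moreover have "AE x in lebesgue. x \<in> {a..a + real n} \<longrightarrow> Im (F x - G x) = 0"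
    proof (rule AE_zero_if_indefinite_integral_zero)
      show "(\<lambda>x. Im (F x - G x)) absolutely_integrable_on {a..a + real n}"
        using absolutely_integrable_linear[OF d bounded_linear_Im] by (simp add: o_def)
      fix t assume "a \<le> t"
      from has_integral_linear[OF z[OF this] bounded_linear_Im]
      show "integral {a..t} (\<lambda>x. Im (F x - G x)) = 0" by (intro integral_unique) (simp add: o_def)
    qed
    ultimately show ?thesis by eventually_elim (auto simp: complex_eq_iff)
  qed
  then have "AE x in lebesgue. \<forall>n. x \<in> {a..a + real n} \<longrightarrow> F x = G x"
    by (intro AE_all_countable[THEN iffD2] allI)
  then show ?thesis
  proof eventually_elim
    case (elim x)
    obtain n :: nat where "x - a \<le> real n" using real_arch_simple by blast
    then show ?case using elim[rule_format, of n] by auto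
  qed
qed

section \<open>The domain of the differential expression\<close>

lemma at_within_halfline_nontrivial:
  fixes x :: real
  assumes "a \<le> x"
  shows "at x within {a..} \<noteq> bot"
  using assms at_within_halfline[OF assms] islimpt_Icc[of a "x+1" x] trivial_limit_within[of x "{a..x+1}"]
  by auto

lemma regularD:
  assumes "regular a y"
  shows "ac_derivative a y (D1 a y)" "ac_derivative a (D1 a y) (D2 a y)"
proof -
  obtain g where "ac_derivative a (D1 a y) g"
    using assms by (auto simp: regular_def locally_ac_def)
  then show D2: "ac_derivative a (D1 a y) (D2 a y)"
    unfolding D2_def by (rule someI[of "ac_derivative a (D1 a y)"])
  have d: "(y has_vector_derivative D1 a y x) (at x within {a..})" if "a \<le> x" for x
    using assms that unfolding D1_def by (auto simp: regular_def vector_derivative_works[symmetric])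
  have c: "continuous_on {a..} (D1 a y)" by (rule ac_derivative_continuous_on[OF D2])
  show "ac_derivative a y (D1 a y)"
  proof (rule ac_derivativeI)
    show "locally_summable a (D1 a y)" by (rule locally_summable_continuous[OF c])
    fix x assume x: "a \<le> x"
    have "(D1 a y has_integral y x - y a) {a..x}"
      by (rule fundamental_theorem_of_calculus[OF x])
        (auto intro!: has_vector_derivative_within_subset[OF d])
    then have "integral {a..x} (D1 a y) = y x - y a" by (rule integral_unique)
    then show "y x = y a + integral {a..x} (D1 a y)" by simp
  qed
qed

lemma ac_derivative_has_vector_derivative:
  assumes f: "ac_derivative a f F" and F: "continuous_on {a..} F" and x: "a \<le> x"
  shows "(f has_vector_derivative F x) (at x within {a..})"
proof -
  have "((\<lambda>u. integral {a..u} F) has_vector_derivative F x) (at x within {a..x+1})"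
    by (rule integral_has_vector_derivative) (use F x in \<open>auto intro: continuous_on_subset\<close>)
  then have "((\<lambda>u. f a + integral {a..u} F) has_vector_derivative 0 + F x) (at x within {a..})"
    unfolding at_within_halfline[OF x] by (intro has_vector_derivative_add has_vector_derivative_const)
  then show ?thesis
    unfolding add_0 by (rule has_vector_derivative_transform[rotated -1])
      (use x ac_derivative_eq[OF f, symmetric] in auto)
qed

text \<open>
  Every function of the maximal domain below is constructed together with its two densities; this lemma translates
  such a description into the notions defined by choice, \<open>D1\<close>, \<open>D2\<close> and \<open>schr\<close>.
\<close>

lemma regularI:
  assumes y: "ac_derivative a y y1" and y1: "ac_derivative a y1 y2"
  shows "regular a y" "\<And>x. a \<le> x \<Longrightarrow> D1 a y x = y1 x"
    "AE x\<in>{a..} in lebesgue. schr q a y x = - y2 x + complex_of_real (q x) * y x"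
proof -
  note d = ac_derivative_has_vector_derivative[OF y ac_derivative_continuous_on[OF y1]]
  show D1: "D1 a y x = y1 x" if "a \<le> x" for x
    unfolding D1_def by (rule vector_derivative_within[OF at_within_halfline_nontrivial[OF that] d[OF that]])
  have D2: "ac_derivative a (D1 a y) y2"
    by (rule ac_derivative_cong[OF y1]) (simp_all add: D1)
  show r: "regular a y"
    unfolding regular_def
  proof (intro conjI allI impI)
    show "locally_ac a y" using y by (auto simp: locally_ac_def)
    show "locally_ac a (D1 a y)" using D2 by (auto simp: locally_ac_def)
    fix x assume "a \<le> x"
    from d[OF this] show "y differentiable at x within {a..}"
      by (auto simp: has_vector_derivative_def differentiable_def)
  qed
  have "AE x\<in>{a..} in lebesgue. D2 a y x = y2 x"
    by (rule ac_derivative_unique[OF regularD(2)[OF r] D2])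
  then show "AE x\<in>{a..} in lebesgue. schr q a y x = - y2 x + complex_of_real (q x) * y x"
    by eventually_elim (auto simp: schr_def)
qed

section \<open>The Hilbert space of square integrable functions\<close>

lemma L2_measurable:
  "f \<in> L2 a \<Longrightarrow> (\<lambda>x. indicat_real {a..} x *\<^sub>R f x) \<in> borel_measurable lebesgue"
  by (simp add: L2_def set_borel_measurable_def)

lemma L2_square_integrable:
  "f \<in> L2 a \<Longrightarrow> set_integrable lebesgue {a..} (\<lambda>x. (cmod (f x))\<^sup>2)"
  by (simp add: L2_def)

lemma L2I:
  assumes f: "set_borel_measurable lebesgue {a..} f"
    and g: "set_integrable lebesgue {a..} g"
    and b: "AE x\<in>{a..} in lebesgue. (cmod (f x))\<^sup>2 \<le> g x"
  shows "f \<in> L2 a"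
proof -
  have m: "(\<lambda>x. indicat_real {a..} x *\<^sub>R f x) \<in> borel_measurable lebesgue"
    using f by (simp add: set_borel_measurable_def)
  have "(\<lambda>x. (cmod (indicat_real {a..} x *\<^sub>R f x))\<^sup>2) \<in> borel_measurable lebesgue"
    using m by measurable
  moreover have "(\<lambda>x. (cmod (indicat_real {a..} x *\<^sub>R f x))\<^sup>2) = (\<lambda>x. indicat_real {a..} x *\<^sub>R (cmod (f x))\<^sup>2)"
    by (auto simp: indicator_def)
  ultimately have m2: "set_borel_measurable lebesgue {a..} (\<lambda>x. (cmod (f x))\<^sup>2)"
    by (simp add: set_borel_measurable_def)
  have "set_integrable lebesgue {a..} (\<lambda>x. (cmod (f x))\<^sup>2)"
    by (rule set_integrable_bound[OF g m2]) (use b in \<open>eventually_elim, auto\<close>)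
  then show ?thesis using f by (simp add: L2_def)
qed

lemma L2_cong_AE:
  assumes f: "f \<in> L2 a" and fg: "AE x\<in>{a..} in lebesgue. f x = g x"
  shows "g \<in> L2 a"
proof (rule L2I)
  have "(\<lambda>x. indicat_real {a..} x *\<^sub>R g x) \<in> borel_measurable lebesgue"
    by (rule borel_measurable_AE[OF L2_measurable[OF f]]) (use fg in \<open>eventually_elim, auto simp: indicator_def\<close>)
  then show "set_borel_measurable lebesgue {a..} g" by (simp add: set_borel_measurable_def)
  show "set_integrable lebesgue {a..} (\<lambda>x. (cmod (f x))\<^sup>2)" by (rule L2_square_integrable[OF f])
  show "AE x\<in>{a..} in lebesgue. (cmod (g x))\<^sup>2 \<le> (cmod (f x))\<^sup>2"
    using fg by eventually_elim auto
qed

lemma L2_lincomb: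
  assumes f: "f \<in> L2 a" and g: "g \<in> L2 a"
  shows "(\<lambda>x. c * f x + d * g x) \<in> L2 a"
proof (rule L2I)
  have "(\<lambda>x. c * (indicat_real {a..} x *\<^sub>R f x) + d * (indicat_real {a..} x *\<^sub>R g x)) \<in> borel_measurable lebesgue"
    using L2_measurable[OF f] L2_measurable[OF g] by measurable
  then show "set_borel_measurable lebesgue {a..} (\<lambda>x. c * f x + d * g x)"
    by (simp add: set_borel_measurable_def algebra_simps)
  show "set_integrable lebesgue {a..}
      (\<lambda>x. (2 * (cmod c)\<^sup>2) * (cmod (f x))\<^sup>2 + (2 * (cmod d)\<^sup>2) * (cmod (g x))\<^sup>2)"
    using f g by (intro set_integral_add set_integrable_mult_right L2_square_integrable)
  show "AE x\<in>{a..} in lebesgue. (cmod (c * f x + d * g x))\<^sup>2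
      \<le> (2 * (cmod c)\<^sup>2) * (cmod (f x))\<^sup>2 + (2 * (cmod d)\<^sup>2) * (cmod (g x))\<^sup>2"
  proof (intro AE_I2 impI)
    fix x
    have "(cmod (c * f x + d * g x))\<^sup>2 \<le> (cmod (c * f x) + cmod (d * g x))\<^sup>2"
      by (intro power_mono norm_triangle_ineq) auto
    also have "\<dots> \<le> 2 * (cmod (c * f x))\<^sup>2 + 2 * (cmod (d * g x))\<^sup>2"
      using sum_squares_bound[of "cmod (c * f x)" "cmod (d * g x)"] by (simp add: power2_sum)
    finally show "(cmod (c * f x + d * g x))\<^sup>2
      \<le> (2 * (cmod c)\<^sup>2) * (cmod (f x))\<^sup>2 + (2 * (cmod d)\<^sup>2) * (cmod (g x))\<^sup>2"
      by (simp add: norm_mult power_mult_distrib)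
  qed
qed

lemma L2_product_integrable:
  assumes f: "f \<in> L2 a" and g: "g \<in> L2 a"
  shows "set_integrable lebesgue {a..} (\<lambda>x. f x * cnj (g x))"
proof (rule set_integrable_bound)
  show "set_integrable lebesgue {a..} (\<lambda>x. (cmod (f x))\<^sup>2 + (cmod (g x))\<^sup>2)"
    using f g by (intro set_integral_add L2_square_integrable)
  have "cnj \<in> borel_measurable borel"
    by (intro borel_measurable_continuous_onI continuous_intros)
  from measurable_compose[OF L2_measurable[OF g] this]
  have "(\<lambda>x. (indicat_real {a..} x *\<^sub>R f x) * cnj (indicat_real {a..} x *\<^sub>R g x)) \<in> borel_measurable lebesgue"
    by (intro borel_measurable_times L2_measurable[OF f])
  moreover have "(\<lambda>x. (indicat_real {a..} x *\<^sub>R f x) * cnj (indicat_real {a..} x *\<^sub>R g x))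
      = (\<lambda>x. indicat_real {a..} x *\<^sub>R (f x * cnj (g x)))"
    by (auto simp: indicator_def)
  ultimately show "set_borel_measurable lebesgue {a..} (\<lambda>x. f x * cnj (g x))"
    by (simp add: set_borel_measurable_def)
  have "cmod (f x) * cmod (g x) \<le> (cmod (f x))\<^sup>2 + (cmod (g x))\<^sup>2" for x
  proof -
    have "0 \<le> cmod (f x) * cmod (g x)" by simp
    then show ?thesis using sum_squares_bound[of "cmod (f x)" "cmod (g x)"] by linarith
  qed
  then show "AE x in lebesgue. x \<in> {a..} \<longrightarrow> norm (f x * cnj (g x)) \<le> norm ((cmod (f x))\<^sup>2 + (cmod (g x))\<^sup>2)"
    by (simp add: norm_mult)
qed

lemma ip_lincomb_left:
  assumes "f \<in> L2 a" "g \<in> L2 a" "h \<in> L2 a"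
  shows "ip a (\<lambda>x. c * f x + d * g x) h = c * ip a f h + d * ip a g h"
proof -
  have "ip a (\<lambda>x. c * f x + d * g x) h
      = (LINT x:{a..}|lebesgue. c * (f x * cnj (h x)) + d * (g x * cnj (h x)))"
    by (simp add: ip_def algebra_simps)
  also have "\<dots> = c * ip a f h + d * ip a g h"
    using assms by (subst set_integral_add) (auto simp: ip_def intro!: L2_product_integrable)
  finally show ?thesis .
qed

lemma ip_cnj: "ip a g f = cnj (ip a f g)"
proof -
  have "cnj (ip a f g) = (LINT x|lebesgue. cnj (indicat_real {a..} x *\<^sub>R (f x * cnj (g x))))"
    unfolding ip_def set_lebesgue_integral_def by (rule Bochner_Integration.integral_cnj[symmetric])
  then show ?thesis by (simp add: ip_def set_lebesgue_integral_def mult.commute)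
qed

lemma ip_lincomb_right:
  assumes "f \<in> L2 a" "g \<in> L2 a" "h \<in> L2 a"
  shows "ip a h (\<lambda>x. c * f x + d * g x) = cnj c * ip a h f + cnj d * ip a h g"
  using ip_lincomb_left[OF assms, of c d] by (metis complex_cnj_add complex_cnj_mult ip_cnj)

lemma ip_cong_AE:
  assumes f: "f \<in> L2 a" and h: "h \<in> L2 a" and fg: "AE x\<in>{a..} in lebesgue. f x = g x"
  shows "ip a f h = ip a g h"
proof -
  note g = L2_cong_AE[OF f fg]
  show ?thesis unfolding ip_def set_lebesgue_integral_def
  proof (rule integral_cong_AE)
    show "(\<lambda>x. indicat_real {a..} x *\<^sub>R (f x * cnj (h x))) \<in> borel_measurable lebesgue"
      using L2_product_integrable[OF f h] by (auto simp: set_integrable_def dest: borel_measurable_integrable)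
    show "(\<lambda>x. indicat_real {a..} x *\<^sub>R (g x * cnj (h x))) \<in> borel_measurable lebesgue"
      using L2_product_integrable[OF g h] by (auto simp: set_integrable_def dest: borel_measurable_integrable)
    show "AE x in lebesgue. indicat_real {a..} x *\<^sub>R (f x * cnj (h x)) = indicat_real {a..} x *\<^sub>R (g x * cnj (h x))"
      using fg by eventually_elim (auto simp: indicator_def)
  qed
qed

definition norm_sq :: "real \<Rightarrow> (real \<Rightarrow> complex) \<Rightarrow> real" where
  "norm_sq a f = (LINT x:{a..}|lebesgue. (cmod (f x))\<^sup>2)"

lemma ip_self: "ip a f f = complex_of_real (norm_sq a f)"
proof -
  have "ip a f f = (LINT x:{a..}|lebesgue. complex_of_real ((cmod (f x))\<^sup>2))"
    by (simp add: ip_def complex_norm_square[symmetric])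
  then show ?thesis unfolding norm_sq_def by (simp only: set_integral_complex_of_real)
qed

lemma norm_sq_nonneg: "0 \<le> norm_sq a f"
  unfolding norm_sq_def set_lebesgue_integral_def by (rule integral_nonneg_AE) auto

lemma norm_sq_lincomb:
  assumes f: "f \<in> L2 a" and g: "g \<in> L2 a"
  shows "norm_sq a (\<lambda>x. c * f x + d * g x)
    = (cmod c)\<^sup>2 * norm_sq a f + 2 * Re (c * cnj d * ip a f g) + (cmod d)\<^sup>2 * norm_sq a g"
proof -
  have "complex_of_real (norm_sq a (\<lambda>x. c * f x + d * g x))
      = c * (cnj c * ip a f f + cnj d * ip a f g) + d * (cnj c * ip a g f + cnj d * ip a g g)"
    unfolding ip_self[symmetric] using f g
    by (simp add: ip_lincomb_left ip_lincomb_right L2_lincomb)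
  also have "\<dots> = complex_of_real ((cmod c)\<^sup>2) * ip a f f + (c * cnj d * ip a f g + cnj (c * cnj d * ip a f g))
      + complex_of_real ((cmod d)\<^sup>2) * ip a g g"
    unfolding ip_cnj[of a g f] complex_norm_square by (simp add: algebra_simps)
  also have "c * cnj d * ip a f g + cnj (c * cnj d * ip a f g) = complex_of_real (2 * Re (c * cnj d * ip a f g))"
    by (rule complex_add_cnj)
  finally show ?thesis
    unfolding ip_self by (simp only: of_real_mult[symmetric] of_real_add[symmetric] of_real_eq_iff)
qed

text \<open>
  The usual discriminant argument: \<open>f - s p g\<close> with \<open>p = (f, g)\<close> has nonnegative squared norm for all real \<open>s\<close>.
\<close>

lemma ip_Cauchy_Schwarz:
  assumes f: "f \<in> L2 a" and g: "g \<in> L2 a"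
  shows "(cmod (ip a f g))\<^sup>2 \<le> norm_sq a f * norm_sq a g"
proof -
  define p where "p = ip a f g"
  have *: "0 \<le> norm_sq a f - 2 * s * (cmod p)\<^sup>2 + s\<^sup>2 * (cmod p)\<^sup>2 * norm_sq a g" for s :: real
  proof -
    have "0 \<le> norm_sq a (\<lambda>x. 1 * f x + (- (complex_of_real s * p)) * g x)" by (rule norm_sq_nonneg)
    also have "\<dots> = norm_sq a f + 2 * Re (- (complex_of_real s * (p * cnj p))) + (cmod (complex_of_real s * p))\<^sup>2 * norm_sq a g"
      unfolding norm_sq_lincomb[OF f g] by (simp add: p_def algebra_simps)
    also have "\<dots> = norm_sq a f - 2 * s * (cmod p)\<^sup>2 + s\<^sup>2 * (cmod p)\<^sup>2 * norm_sq a g"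
      unfolding complex_norm_square[symmetric] by (simp add: norm_mult power_mult_distrib)
    finally show ?thesis .
  qed
  show ?thesis
  proof (cases "norm_sq a g = 0")
    case True
    have "p = 0"
    proof (rule ccontr)
      assume "p \<noteq> 0"
      then have "(cmod p)\<^sup>2 > 0" by simp
      then have "0 \<le> norm_sq a f - 2 * (norm_sq a f + 1)"
        using *[of "(norm_sq a f + 1) / (cmod p)\<^sup>2"] True by simp
      then show False using norm_sq_nonneg[of a f] by simp
    qed
    then show ?thesis using True by (simp add: p_def)
  next
    case False
    then have G: "norm_sq a g > 0" using norm_sq_nonneg[of a g] by simp
    have "0 \<le> norm_sq a f - (cmod p)\<^sup>2 / norm_sq a g"
      using *[of "1 / norm_sq a g"] G by (simp add: field_simps power2_eq_square)
    then show ?thesis using G by (simp add: p_def field_simps)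
  qed
qed

section \<open>The maximal operator\<close>

lemma DstarD:
  assumes "y \<in> Dstar q a"
  shows "y \<in> L2 a" "regular a y" "schr q a y \<in> L2 a" "x < a \<Longrightarrow> y x = 0"
  using assms by (auto simp: Dstar_def)

lemma regular_lincomb:
  assumes y: "regular a y" and w: "regular a w"
  shows "regular a (\<lambda>x. c * y x + d * w x)"
    and "\<And>x. a \<le> x \<Longrightarrow> D1 a (\<lambda>x. c * y x + d * w x) x = c * D1 a y x + d * D1 a w x"
    and "AE x\<in>{a..} in lebesgue. schr q a (\<lambda>x. c * y x + d * w x) x = c * schr q a y x + d * schr q a w x"
proof -
  note r = regularI[OF
      ac_derivative_add[OF ac_derivative_cmult[OF regularD(1)[OF y], of c] ac_derivative_cmult[OF regularD(1)[OF w], of d]]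
      ac_derivative_add[OF ac_derivative_cmult[OF regularD(2)[OF y], of c] ac_derivative_cmult[OF regularD(2)[OF w], of d]]]
  show "regular a (\<lambda>x. c * y x + d * w x)" by (rule r(1))
  show "\<And>x. a \<le> x \<Longrightarrow> D1 a (\<lambda>x. c * y x + d * w x) x = c * D1 a y x + d * D1 a w x" by (rule r(2))
  show "AE x\<in>{a..} in lebesgue. schr q a (\<lambda>x. c * y x + d * w x) x = c * schr q a y x + d * schr q a w x"
    using r(3)[of q] by eventually_elim (auto simp: schr_def algebra_simps)
qed

lemma Dstar_lincomb:
  assumes y: "y \<in> Dstar q a" and w: "w \<in> Dstar q a"
  shows "(\<lambda>x. c * y x + d * w x) \<in> Dstar q a"
proof -
  note r = regular_lincomb[OF DstarD(2)[OF y] DstarD(2)[OF w], where c=c and d=d]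
  have "(\<lambda>x. c * schr q a y x + d * schr q a w x) \<in> L2 a"
    by (rule L2_lincomb[OF DstarD(3)[OF y] DstarD(3)[OF w]])
  from L2_cong_AE[OF this] have "schr q a (\<lambda>x. c * y x + d * w x) \<in> L2 a"
    using r(3)[where q=q] by (auto simp: eq_commute)
  then show ?thesis
    using y w r(1) L2_lincomb[OF DstarD(1)[OF y] DstarD(1)[OF w], of c d] by (auto simp: Dstar_def)
qed

lemma D1_lincomb:
  assumes "y \<in> Dstar q a" and "w \<in> Dstar q a"
  shows "D1 a (\<lambda>x. c * y x + d * w x) a = c * D1 a y a + d * D1 a w a"
  by (rule regular_lincomb(2)[OF DstarD(2)[OF assms(1)] DstarD(2)[OF assms(2)]]) simp

lemma ip_schr_lincomb:
  assumes y: "y \<in> Dstar q a" and w: "w \<in> Dstar q a" and v: "v \<in> L2 a"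
  shows "ip a (schr q a (\<lambda>x. c * y x + d * w x)) v = c * ip a (schr q a y) v + d * ip a (schr q a w) v"
proof -
  have "ip a (schr q a (\<lambda>x. c * y x + d * w x)) v = ip a (\<lambda>x. c * schr q a y x + d * schr q a w x) v"
    by (rule ip_cong_AE[OF DstarD(3)[OF Dstar_lincomb[OF y w]] v
        regular_lincomb(3)[OF DstarD(2)[OF y] DstarD(2)[OF w]]])
  then show ?thesis
    using ip_lincomb_left[OF DstarD(3)[OF y] DstarD(3)[OF w] v] by simp
qed

text \<open>Elements of the maximal domain vanish to the left of the endpoint.\<close>

definition halfline :: "real \<Rightarrow> (real \<Rightarrow> complex) \<Rightarrow> real \<Rightarrow> complex" where
  "halfline a y x = (if x < a then 0 else y x)"

lemma regular_halfline:
  assumes y: "regular a y"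
  shows "regular a (halfline a y)" "\<And>x. a \<le> x \<Longrightarrow> D1 a (halfline a y) x = D1 a y x"
    "AE x\<in>{a..} in lebesgue. schr q a (halfline a y) x = schr q a y x"
proof -
  have "ac_derivative a (halfline a y) (D1 a y)"
    by (rule ac_derivative_cong[OF regularD(1)[OF y]]) (simp_all add: halfline_def)
  note r = regularI[OF this regularD(2)[OF y]]
  show "regular a (halfline a y)" "\<And>x. a \<le> x \<Longrightarrow> D1 a (halfline a y) x = D1 a y x" by (rule r)+
  show "AE x\<in>{a..} in lebesgue. schr q a (halfline a y) x = schr q a y x"
    using r(3)[of q] by eventually_elim (auto simp: schr_def halfline_def)
qed

lemma halfline_Dstar:
  assumes y: "regular a y" and L: "y \<in> L2 a" and S: "schr q a y \<in> L2 a"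
  shows "halfline a y \<in> Dstar q a"
proof -
  have "halfline a y \<in> L2 a"
    by (rule L2_cong_AE[OF L]) (simp add: halfline_def)
  moreover have "schr q a (halfline a y) \<in> L2 a"
    by (rule L2_cong_AE[OF S]) (use regular_halfline(3)[OF y, of q] in \<open>auto simp: eq_commute\<close>)
  ultimately show ?thesis using regular_halfline(1)[OF y] by (auto simp: Dstar_def halfline_def)
qed

lemma solves_halfline:
  assumes y: "solves q a z y" and L: "y \<in> L2 a"
  shows "halfline a y \<in> Dstar q a" "solves q a z (halfline a y)"
    "halfline a y a = y a" "D1 a (halfline a y) a = D1 a y a"
proof -
  have r: "regular a y" and e: "AE x\<in>{a..} in lebesgue. schr q a y x = z * y x"
    using y by (auto simp: solves_def)
  have "(\<lambda>x. z * y x + 0 * y x) \<in> L2 a" by (rule L2_lincomb[OF L L])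
  then have "schr q a y \<in> L2 a"
    by (rule L2_cong_AE) (use e in \<open>auto simp: eq_commute\<close>)
  then show "halfline a y \<in> Dstar q a" by (rule halfline_Dstar[OF r L])
  show "solves q a z (halfline a y)"
    unfolding solves_def
  proof
    show "AE x\<in>{a..} in lebesgue. schr q a (halfline a y) x = z * halfline a y x"
      using regular_halfline(3)[OF r, of q] e by eventually_elim (auto simp: halfline_def)
  qed (rule regular_halfline(1)[OF r])
  show "halfline a y a = y a" by (simp add: halfline_def)
  show "D1 a (halfline a y) a = D1 a y a" by (rule regular_halfline(2)[OF r]) simp
qed

lemma solves_lincomb:
  assumes y: "solves q a z y" and w: "solves q a z w"
  shows "solves q a z (\<lambda>x. c * y x + d * w x)"
proof -
  have r: "regular a y" "regular a w" using y w by (auto simp: solves_def)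
  have "AE x\<in>{a..} in lebesgue. schr q a y x = z * y x" "AE x\<in>{a..} in lebesgue. schr q a w x = z * w x"
    using y w by (auto simp: solves_def)
  with regular_lincomb(3)[OF r, where q=q and c=c and d=d]
  have "AE x\<in>{a..} in lebesgue. schr q a (\<lambda>x. c * y x + d * w x) x = z * (c * y x + d * w x)"
    by eventually_elim (auto simp: algebra_simps)
  then show ?thesis using regular_lincomb(1)[OF r] by (simp add: solves_def)
qed

lemma ip_schr_solves:
  assumes "y \<in> Dstar q a" "solves q a z y" "v \<in> L2 a"
  shows "ip a (schr q a y) v = z * ip a y v"
proof -
  have "ip a (schr q a y) v = ip a (\<lambda>x. z * y x + 0 * y x) v"
    by (rule ip_cong_AE) (use assms in \<open>auto simp: solves_def DstarD\<close>)
  also have "\<dots> = z * ip a y v"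
    using ip_lincomb_left[OF DstarD(1)[OF assms(1)] DstarD(1)[OF assms(1)] assms(3), of z 0] by simp
  finally show ?thesis .
qed

section \<open>The Lagrange bracket at infinity\<close>

definition bracket :: "real \<Rightarrow> (real \<Rightarrow> complex) \<Rightarrow> (real \<Rightarrow> complex) \<Rightarrow> real \<Rightarrow> complex" where
  "bracket a y w x = y x * cnj (D1 a w x) - D1 a y x * cnj (w x)"

text \<open>
  Green's identity on \<open>[a, x]\<close>. The potential cancels because \<open>q\<close> is real, so only \<open>y cnj w'' - y'' cnj w\<close> remains.
\<close>

lemma bracket_ac:
  assumes y: "regular a y" and w: "regular a w"
  shows "ac_derivative a (bracket a y w) (\<lambda>x. schr q a y x * cnj (w x) - y x * cnj (schr q a w x))"
proof -
  note r = regularD[OF y] ac_derivative_cnj[OF regularD(1)[OF w]] ac_derivative_cnj[OF regularD(2)[OF w]]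
  note d = ac_derivative_add[OF ac_derivative_mult[OF r(1,4)] ac_derivative_cmult[OF ac_derivative_mult[OF r(2,3)], of "-1"]]
  show ?thesis
    by (rule ac_derivative_cong[OF d]) (simp_all add: bracket_def schr_def algebra_simps)
qed

lemma bracket_tendsto:
  assumes y: "y \<in> Dstar q a" and w: "w \<in> Dstar q a"
  shows "(bracket a y w \<longlongrightarrow> bracket a y w a + (ip a (schr q a y) w - ip a y (schr q a w))) at_top"
proof -
  define g where "g = (\<lambda>x. schr q a y x * cnj (w x) - y x * cnj (schr q a w x))"
  note ac = bracket_ac[OF DstarD(2)[OF y] DstarD(2)[OF w], of q, folded g_def]
  have i: "set_integrable lebesgue {a..} (\<lambda>x. schr q a y x * cnj (w x))"
    "set_integrable lebesgue {a..} (\<lambda>x. y x * cnj (schr q a w x))"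
    using y w by (auto intro!: L2_product_integrable simp: DstarD)
  have gi: "set_integrable lebesgue {a..} g"
    unfolding g_def by (rule set_integral_diff(1)[OF i])
  have gv: "(LINT x:{a..}|lebesgue. g x) = ip a (schr q a y) w - ip a y (schr q a w)"
    unfolding g_def ip_def by (rule set_integral_diff(2)[OF i])
  have "((\<lambda>b. LINT x:{a..b}|lebesgue. g x) \<longlongrightarrow> (LINT x:{a..}|lebesgue. g x)) at_top"
    by (rule tendsto_set_lebesgue_integral_at_top[OF _ gi]) auto
  then have "((\<lambda>b. bracket a y w a + (LINT x:{a..b}|lebesgue. g x)) \<longlongrightarrow>
      bracket a y w a + (ip a (schr q a y) w - ip a y (schr q a w))) at_top"
    unfolding gv by (intro tendsto_intros)
  moreover have "\<forall>\<^sub>F b in at_top. bracket a y w a + (LINT x:{a..b}|lebesgue. g x) = bracket a y w b"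
    using eventually_ge_at_top[of a]
  proof eventually_elim
    case (elim b)
    have "g absolutely_integrable_on {a..b}"
      by (rule locally_summable_absolutely_integrable[OF ac_derivative_summable[OF ac]]) simp
    then show ?case
      using ac_derivative_eq[OF ac elim] set_lebesgue_integral_eq_integral(2) by metis
  qed
  ultimately show ?thesis by (rule Lim_transform_eventually)
qed

text \<open>Truncation at \<open>b\<close> turns integrals over \<open>[a, b]\<close> into inner products.\<close>

definition trunc :: "real \<Rightarrow> (real \<Rightarrow> complex) \<Rightarrow> real \<Rightarrow> complex" where
  "trunc b f x = (if x \<le> b then f x else 0)"

lemma trunc_L2:
  assumes c: "continuous_on {a..} f"
  shows "trunc b f \<in> L2 a"
proof (rule L2I)
  have cb: "continuous_on {a..b} f" by (rule continuous_on_subset[OF c]) auto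
  have "(\<lambda>x. indicat_real {a..b} x *\<^sub>R f x) \<in> borel_measurable lebesgue"
    using absolutely_integrable_continuous_real[OF cb]
    by (auto simp: set_integrable_def dest: borel_measurable_integrable)
  moreover have "(\<lambda>x. indicat_real {a..b} x *\<^sub>R f x) = (\<lambda>x. indicat_real {a..} x *\<^sub>R trunc b f x)"
    by (auto simp: indicator_def trunc_def)
  ultimately show "set_borel_measurable lebesgue {a..} (trunc b f)"
    by (simp add: set_borel_measurable_def)
  have "(\<lambda>x. (cmod (f x))\<^sup>2) absolutely_integrable_on {a..b}"
    by (intro absolutely_integrable_continuous_real continuous_intros cb)
  moreover have "(\<lambda>x. indicat_real {a..b} x *\<^sub>R (cmod (f x))\<^sup>2) = (\<lambda>x. indicat_real {a..} x *\<^sub>R (cmod (trunc b f x))\<^sup>2)"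
    by (auto simp: indicator_def trunc_def)
  ultimately show "set_integrable lebesgue {a..} (\<lambda>x. (cmod (trunc b f x))\<^sup>2)"
    by (simp add: set_integrable_def)
qed simp

lemma trunc_in_L2:
  assumes f: "f \<in> L2 a"
  shows "trunc b f \<in> L2 a"
proof (rule L2I[OF _ L2_square_integrable[OF f]])
  have "(\<lambda>x. indicat_real {..b} x *\<^sub>R (indicat_real {a..} x *\<^sub>R f x)) \<in> borel_measurable lebesgue"
    by (rule borel_measurable_scaleR[OF borel_measurable_indicator L2_measurable[OF f]]) simp
  moreover have "(\<lambda>x. indicat_real {..b} x *\<^sub>R (indicat_real {a..} x *\<^sub>R f x)) = (\<lambda>x. indicat_real {a..} x *\<^sub>R trunc b f x)"
    by (auto simp: indicator_def trunc_def)
  ultimately show "set_borel_measurable lebesgue {a..} (trunc b f)"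
    by (simp add: set_borel_measurable_def)
qed (auto simp: trunc_def)

lemma ip_trunc: "ip a (trunc b f) g = ip a (trunc b f) (trunc b g)"
  unfolding ip_def by (intro arg_cong[where f="\<lambda>h. set_lebesgue_integral lebesgue {a..} h"]) (auto simp: trunc_def)

lemma ip_trunc_trunc:
  assumes "c \<le> b"
  shows "ip a (trunc b f) (trunc c g) = ip a (trunc c f) g"
  unfolding ip_def using assms
  by (intro arg_cong[where f="\<lambda>h. set_lebesgue_integral lebesgue {a..} h"]) (auto simp: trunc_def)

lemma norm_sq_tail:
  assumes k: "k \<in> L2 a"
  shows "((\<lambda>c. norm_sq a (\<lambda>x. 1 * k x + (-1) * trunc c k x)) \<longlongrightarrow> 0) at_top"
proof -
  note sq = L2_square_integrable[OF k]
  have "((\<lambda>c. LINT x:{a..c}|lebesgue. (cmod (k x))\<^sup>2) \<longlongrightarrow> (LINT x:{a..}|lebesgue. (cmod (k x))\<^sup>2)) at_top"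
    by (rule tendsto_set_lebesgue_integral_at_top[OF _ sq]) auto
  then have t: "((\<lambda>c. norm_sq a k - (LINT x:{a..c}|lebesgue. (cmod (k x))\<^sup>2)) \<longlongrightarrow> norm_sq a k - norm_sq a k) at_top"
    unfolding norm_sq_def by (intro tendsto_intros)
  have "norm_sq a k - (LINT x:{a..c}|lebesgue. (cmod (k x))\<^sup>2) = norm_sq a (\<lambda>x. 1 * k x + (-1) * trunc c k x)" for c
  proof -
    have i: "set_integrable lebesgue ({a..} \<inter> {..c}) (\<lambda>x. (cmod (k x))\<^sup>2)" "set_integrable lebesgue ({a..} \<inter> {c<..}) (\<lambda>x. (cmod (k x))\<^sup>2)"
      by (rule set_integrable_subset[OF sq]; simp)+
    have "norm_sq a k = (LINT x:({a..} \<inter> {..c}) \<union> ({a..} \<inter> {c<..})|lebesgue. (cmod (k x))\<^sup>2)"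
      unfolding norm_sq_def by (rule arg_cong[where f="\<lambda>S. LINT x:S|lebesgue. (cmod (k x))\<^sup>2"]) auto
    also have "\<dots> = (LINT x:{a..} \<inter> {..c}|lebesgue. (cmod (k x))\<^sup>2) + (LINT x:{a..} \<inter> {c<..}|lebesgue. (cmod (k x))\<^sup>2)"
      by (rule set_integral_Un[OF _ i]) auto
    also have "{a..} \<inter> {..c} = {a..c}" by auto
    also have "(LINT x:{a..} \<inter> {c<..}|lebesgue. (cmod (k x))\<^sup>2) = norm_sq a (\<lambda>x. 1 * k x + (-1) * trunc c k x)"
      unfolding norm_sq_def set_lebesgue_integral_def
      by (rule arg_cong[where f="\<lambda>h. integral\<^sup>L lebesgue h"]) (auto simp: indicator_def trunc_def)
    finally show ?thesis by simp
  qed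
  then show ?thesis using t by simp
qed

lemma norm_sq_trunc_mono:
  assumes c: "continuous_on {a..} f" and "b \<le> b'"
  shows "norm_sq a (trunc b f) \<le> norm_sq a (trunc b' f)"
  unfolding norm_sq_def
  by (intro set_integral_mono L2_square_integrable trunc_L2[OF c]) (use assms in \<open>auto simp: trunc_def\<close>)

text \<open>
  If the norms over \<open>[a, b]\<close> stayed bounded, then monotone convergence would make \<open>f\<close> square integrable.
\<close>

lemma norm_sq_trunc_at_top:
  assumes c: "continuous_on {a..} f" and f: "f \<notin> L2 a"
  shows "filterlim (\<lambda>b. norm_sq a (trunc b f)) at_top at_top"
proof -
  have "\<exists>b. norm_sq a (trunc b f) \<ge> C" for C
  proof (rule ccontr)
    assume "\<not> ?thesis"
    then have C: "norm_sq a (trunc b f) \<le> C" for b by (metis linear)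
    define F where "F = (\<lambda>n x. indicat_real {a..} x *\<^sub>R (cmod (trunc (a + real n) f x))\<^sup>2)"
    have inc: "incseq (\<lambda>n. norm_sq a (trunc (a + real n) f))"
      by (intro monoI norm_sq_trunc_mono[OF c]) auto
    from incseq_convergent[OF inc, of C] C obtain L where
      L: "(\<lambda>n. norm_sq a (trunc (a + real n) f)) \<longlonglongrightarrow> L" by blast
    have lim: "(\<lambda>n. F n x) \<longlonglongrightarrow> indicat_real {a..} x *\<^sub>R (cmod (f x))\<^sup>2" for x
    proof -
      have "\<forall>\<^sub>F n in sequentially. x \<le> a + real n"
        using real_arch_simple[of "x - a"] by (auto simp: eventually_sequentially algebra_simps)
          (metis add_mono_thms_linordered_semiring(2) of_nat_le_iff order_trans)
      then have "\<forall>\<^sub>F n in sequentially. F n x = indicat_real {a..} x *\<^sub>R (cmod (f x))\<^sup>2"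
        by eventually_elim (simp add: F_def trunc_def)
      then show ?thesis by (rule tendsto_eventually)
    qed
    have Fi: "integrable lebesgue (F n)" for n
      using L2_square_integrable[OF trunc_L2[OF c], of "a + real n"] by (simp add: F_def set_integrable_def)
    have "integrable lebesgue (\<lambda>x. indicat_real {a..} x *\<^sub>R (cmod (f x))\<^sup>2)"
    proof (rule integrable_monotone_convergence[where f=F])
      show "integrable lebesgue (F n)" for n by (rule Fi)
      show "AE x in lebesgue. mono (\<lambda>n. F n x)"
        by (auto simp: mono_def F_def trunc_def intro!: AE_I2)
      show "AE x in lebesgue. (\<lambda>n. F n x) \<longlonglongrightarrow> indicat_real {a..} x *\<^sub>R (cmod (f x))\<^sup>2"
        using lim by simp
      show "(\<lambda>n. integral\<^sup>L lebesgue (F n)) \<longlonglongrightarrow> L"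
        using L by (simp add: norm_sq_def set_lebesgue_integral_def F_def)
      show "(\<lambda>x. indicat_real {a..} x *\<^sub>R (cmod (f x))\<^sup>2) \<in> borel_measurable lebesgue"
        by (rule borel_measurable_LIMSEQ_real[OF lim]) (use Fi in \<open>auto dest: borel_measurable_integrable\<close>)
    qed
    then have "set_integrable lebesgue {a..} (\<lambda>x. (cmod (f x))\<^sup>2)" by (simp add: set_integrable_def)
    moreover have "set_borel_measurable lebesgue {a..} f"
    proof -
      have "f \<in> borel_measurable (lebesgue_on {a..})"
        by (rule continuous_imp_measurable_on_sets_lebesgue[OF c]) simp
      then show ?thesis
        unfolding set_borel_measurable_def by (subst (asm) borel_measurable_restrict_space_iff) (auto simp: mult.commute)
    qed
    ultimately show False using f by (simp add: L2_def)
  qed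
  then show ?thesis
    unfolding filterlim_at_top eventually_at_top_linorder
    using norm_sq_trunc_mono[OF c] by (meson order_trans)
qed

text \<open>
  For \<open>k\<close> square integrable, the inner product over \<open>[a, b]\<close> is of smaller order than the norm of \<open>f\<close> over \<open>[a, b]\<close>,
  and so is any constant \<open>p\<close>: split \<open>k\<close> at a point \<open>c\<close> beyond which its norm is small. The part up to \<open>c\<close> does not depend on \<open>b\<close>, and
  Cauchy-Schwarz bounds the tail.
\<close>

lemma ip_trunc_small:
  assumes c: "continuous_on {a..} f" and f: "f \<notin> L2 a" and k: "k \<in> L2 a" and e: "e > 0"
  shows "\<forall>\<^sub>F b in at_top. (cmod (p + ip a (trunc b f) k))\<^sup>2 \<le> e * norm_sq a (trunc b f)"
proof -
  have "\<forall>\<^sub>F c in at_top. norm_sq a (\<lambda>x. 1 * k x + (-1) * trunc c k x) < e / 4"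
    using order_tendstoD(2)[OF norm_sq_tail[OF k], of "e/4"] e by simp
  then obtain c where R: "norm_sq a (\<lambda>x. 1 * k x + (-1) * trunc c k x) < e / 4"
    by (metis (mono_tags, lifting) eventually_at_top_linorder order_refl)
  define P where "P = p + ip a (trunc c f) k"
  have "\<forall>\<^sub>F b in at_top. 4 * (cmod P)\<^sup>2 / e \<le> norm_sq a (trunc b f)"
    using norm_sq_trunc_at_top[OF c f] by (simp add: filterlim_at_top)
  with eventually_ge_at_top[of c] show ?thesis
  proof eventually_elim
    case (elim b)
    define r where "r = (\<lambda>x. 1 * k x + (-1) * trunc c k x)"
    have rL: "r \<in> L2 a" unfolding r_def by (rule L2_lincomb[OF k trunc_in_L2[OF k]])
    note t = trunc_L2[OF c, of b]
    have "ip a (trunc b f) r = cnj 1 * ip a (trunc b f) k + cnj (-1) * ip a (trunc b f) (trunc c k)"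
      unfolding r_def by (rule ip_lincomb_right[OF k trunc_in_L2[OF k] t])
    then have "p + ip a (trunc b f) k = P + ip a (trunc b f) r"
      using ip_trunc_trunc[OF elim(1), of a f k] by (simp add: P_def)
    then have "(cmod (p + ip a (trunc b f) k))\<^sup>2 \<le> (cmod P + cmod (ip a (trunc b f) r))\<^sup>2"
      by (simp add: power_mono norm_triangle_ineq)
    also have "\<dots> \<le> 2 * (cmod P)\<^sup>2 + 2 * (cmod (ip a (trunc b f) r))\<^sup>2"
      using sum_squares_bound[of "cmod P" "cmod (ip a (trunc b f) r)"] by (simp add: power2_sum)
    also have "\<dots> \<le> 2 * (cmod P)\<^sup>2 + 2 * (norm_sq a (trunc b f) * norm_sq a r)"
      using ip_Cauchy_Schwarz[OF t rL] by simp
    also have "\<dots> \<le> 2 * (cmod P)\<^sup>2 + 2 * (norm_sq a (trunc b f) * (e/4))"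
      using R norm_sq_nonneg[of a "trunc b f"] unfolding r_def[symmetric]
      by (intro add_left_mono mult_left_mono) auto
    also have "2 * (cmod P)\<^sup>2 \<le> e / 2 * norm_sq a (trunc b f)"
      using elim(2) e by (simp add: field_simps)
    finally show ?case by simp
  qed
qed

text \<open>
  When \<open>l(f) = z f\<close>, the integrand \<open>l(f) cnj w - f cnj (l(w))\<close> of Green's identity is \<open>f cnj (cnj z w - l(w))\<close>.
\<close>

lemma bracket_solution:
  assumes f: "solves q a z f" and w: "regular a w" and b: "a \<le> b"
  shows "bracket a f w b = bracket a f w a + ip a (trunc b f) (\<lambda>x. cnj z * w x - schr q a w x)"
proof -
  have r: "regular a f" and e: "AE x\<in>{a..} in lebesgue. schr q a f x = z * f x"
    using f by (auto simp: solves_def)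
  define g where "g = (\<lambda>x. schr q a f x * cnj (w x) - f x * cnj (schr q a w x))"
  define k where "k = (\<lambda>x. cnj z * w x - schr q a w x)"
  note ac = bracket_ac[OF r w, of q, folded g_def]
  have gi: "g absolutely_integrable_on {a..b}"
    by (rule locally_summable_absolutely_integrable[OF ac_derivative_summable[OF ac]]) simp
  then have m: "(\<lambda>x. indicat_real {a..b} x *\<^sub>R g x) \<in> borel_measurable lebesgue"
    by (auto simp: set_integrable_def dest: borel_measurable_integrable)
  have ae: "AE x in lebesgue. indicat_real {a..b} x *\<^sub>R g x = indicat_real {a..} x *\<^sub>R (trunc b f x * cnj (k x))"
    using e by eventually_elim (auto simp: indicator_def g_def k_def trunc_def algebra_simps)
  have "integral {a..b} g = (LINT x:{a..b}|lebesgue. g x)"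
    by (rule set_lebesgue_integral_eq_integral(2)[OF gi, symmetric])
  also have "\<dots> = ip a (trunc b f) k"
    unfolding set_lebesgue_integral_def ip_def
    by (rule integral_cong_AE[OF m borel_measurable_AE[OF m ae] ae])
  finally show ?thesis using ac_derivative_eq[OF ac b] by (simp add: k_def)
qed

lemma bracket_solution_self:
  assumes f: "solves q a z f" and b: "a \<le> b"
  shows "bracket a f f b = bracket a f f a + 2 * \<i> * Im z * norm_sq a (trunc b f)"
proof -
  have r: "regular a f" and e: "AE x\<in>{a..} in lebesgue. schr q a f x = z * f x"
    using f by (auto simp: solves_def)
  define k where "k = (\<lambda>x. cnj z * f x - schr q a f x)"
  have t: "trunc b f \<in> L2 a" by (rule trunc_L2[OF ac_derivative_continuous_on[OF regularD(1)[OF r]]])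
  have l: "(\<lambda>x. (cnj z - z) * trunc b f x + 0 * trunc b f x) \<in> L2 a" by (rule L2_lincomb[OF t t])
  have ae: "AE x\<in>{a..} in lebesgue. (cnj z - z) * trunc b f x + 0 * trunc b f x = trunc b k x"
    using e by eventually_elim (auto simp: k_def trunc_def algebra_simps)
  have "ip a (trunc b f) k = ip a (trunc b f) (trunc b k)" by (rule ip_trunc)
  also have "\<dots> = cnj (ip a (trunc b k) (trunc b f))" by (rule ip_cnj)
  also have "ip a (trunc b k) (trunc b f) = ip a (\<lambda>x. (cnj z - z) * trunc b f x + 0 * trunc b f x) (trunc b f)"
    by (rule ip_cong_AE[OF l t ae, symmetric])
  also have "\<dots> = (cnj z - z) * norm_sq a (trunc b f)"
    unfolding ip_lincomb_left[OF t t t] ip_self by simp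
  also have "cnj \<dots> = 2 * \<i> * Im z * norm_sq a (trunc b f)"
    by (simp add: complex_eq_iff)
  finally show ?thesis using bracket_solution[OF f r b] by (simp add: k_def)
qed

text \<open>
  The two sides differ by \<open>|f y' - f' y|\<^sup>2\<close>: this is the Pluecker relation between the \<open>2 \<times> 2\<close> minors formed from
  \<open>(f, f')\<close>, \<open>(y, y')\<close> and their conjugates. The inequality goes in the reverse direction because the form
  \<open>Im y cnj y'\<close> has signature (1,1).
\<close>

lemma bracket_reverse_Cauchy_Schwarz:
  "4 * Im (y * cnj y') * Im (f * cnj f') \<le> (cmod (f * cnj y' - f' * cnj y))\<^sup>2"
proof -
  have "(cmod (f * cnj y' - f' * cnj y))\<^sup>2 - (cmod (f * y' - f' * y))\<^sup>2 = 4 * Im (y * cnj y') * Im (f * cnj f')"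
    unfolding cmod_power2 by (simp add: power2_eq_square algebra_simps)
  then show ?thesis using zero_le_power2[of "cmod (f * y' - f' * y)"] by linarith
qed

text \<open>
  Let \<open>N\<close> be the squared norm of \<open>f\<close> over \<open>[a, b]\<close>. The bracket of \<open>f\<close> with itself at \<open>b\<close> is \<open>2 \<i> (Im z) N\<close>, so the
  reverse Cauchy-Schwarz inequality bounds \<open>2 (Im z) N\<close> times \<open>Im [y, y]\<close> by \<open>|[f, y]|\<^sup>2\<close>, which is eventually at
  most \<open>e N\<close>.
\<close>

lemma bracket_limit_sign:
  assumes f: "solves q a z f" "f a = 0" "f \<notin> L2 a" and y: "y \<in> Dstar q a"
    and L: "(bracket a y y \<longlongrightarrow> L) at_top"
  shows "Im z * Im L \<le> 0"
proof (rule field_le_epsilon)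
  fix e :: real assume e: "e > 0"
  have r: "regular a f" using f by (auto simp: solves_def)
  note ry = DstarD(2)[OF y]
  define k where "k = (\<lambda>x. cnj z * y x - schr q a y x)"
  have kL: "k \<in> L2 a"
    using L2_lincomb[OF DstarD(1)[OF y] DstarD(3)[OF y], of "cnj z" "-1"] by (simp add: k_def)
  note c = ac_derivative_continuous_on[OF regularD(1)[OF r]]
  have "\<forall>\<^sub>F b in at_top. 1 \<le> norm_sq a (trunc b f)"
    using norm_sq_trunc_at_top[OF c f(3)] by (simp add: filterlim_at_top)
  with ip_trunc_small[OF c f(3) kL e, of "bracket a f y a"] eventually_ge_at_top[of a]
  have "\<forall>\<^sub>F b in at_top. 2 * (Im z * Im (bracket a y y b)) \<le> e"
  proof eventually_elim
    case (elim b)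
    define N where "N = norm_sq a (trunc b f)"
    have 1: "bracket a f y b = bracket a f y a + ip a (trunc b f) k"
      unfolding k_def by (rule bracket_solution[OF f(1) ry elim(2)])
    have "bracket a f f b = 2 * \<i> * Im z * N"
      using bracket_solution_self[OF f(1) elim(2)] f(2) by (simp add: N_def bracket_def)
    then have "Im (bracket a f f b) = 2 * (Im z * N)" by simp
    moreover have "Im (bracket a f f b) = 2 * Im (f b * cnj (D1 a f b))" "Im (bracket a y y b) = 2 * Im (y b * cnj (D1 a y b))"
      by (simp_all add: bracket_def)
    ultimately have 2: "4 * Im (y b * cnj (D1 a y b)) * Im (f b * cnj (D1 a f b)) = 2 * Im (bracket a y y b) * (Im z * N)"
      by simp
    have "2 * Im (bracket a y y b) * (Im z * N) \<le> (cmod (bracket a f y b))\<^sup>2"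
      using bracket_reverse_Cauchy_Schwarz[of "y b" "D1 a y b" "f b" "D1 a f b"]
      unfolding 2 bracket_def[of a f y, symmetric] .
    also have "\<dots> \<le> e * N" using elim(1) by (simp add: 1 N_def)
    finally have "2 * (Im z * Im (bracket a y y b)) * N \<le> e * N" by (simp add: algebra_simps)
    then show ?case using elim(3) by (simp add: N_def)
  qed
  moreover have "((\<lambda>b. 2 * (Im z * Im (bracket a y y b))) \<longlongrightarrow> 2 * (Im z * Im L)) at_top"
    by (intro tendsto_intros L)
  ultimately have "2 * (Im z * Im L) \<le> e"
    by (intro tendsto_upperbound[of _ _ at_top]) auto
  then show "Im z * Im L \<le> 0 + e" using e by simp
qed

lemma bracket_vanishes_at_infinity:
  assumes f: "solves q a \<i> f" "f a = 0" "f \<notin> L2 a"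
    and g: "solves q a (- \<i>) g" "g a = 0" "g \<notin> L2 a" and y: "y \<in> Dstar q a"
  shows "bracket a y y a + (ip a (schr q a y) y - ip a y (schr q a y)) = 0"
proof -
  define L where "L = bracket a y y a + (ip a (schr q a y) y - ip a y (schr q a y))"
  have L: "(bracket a y y \<longlongrightarrow> L) at_top" unfolding L_def by (rule bracket_tendsto[OF y y])
  have "Im L = 0" using bracket_limit_sign[OF f y L] bracket_limit_sign[OF g y L] by simp
  moreover have "Re L = 0"
    using ip_cnj[of a y "schr q a y"] by (simp add: L_def bracket_def)
  ultimately show ?thesis by (simp add: L_def complex_eq_iff)
qed

text \<open>
  In Weyl's limit-point case the boundary form vanishes at infinity. This is recorded as Green's identity on the
  half-line, whose boundary terms then involve the endpoint alone.
\<close>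

definition limit_point :: "(real \<Rightarrow> real) \<Rightarrow> real \<Rightarrow> bool" where
  "limit_point q a \<longleftrightarrow> (\<forall>y\<in>Dstar q a. \<forall>w\<in>Dstar q a.
     ip a (schr q a y) w - ip a y (schr q a w) = D1 a y a * cnj (w a) - y a * cnj (D1 a w a))"

lemma limit_pointI:
  assumes f: "solves q a \<i> f" "f a = 0" "f \<notin> L2 a"
    and g: "solves q a (- \<i>) g" "g a = 0" "g \<notin> L2 a"
  shows "limit_point q a"
  unfolding limit_point_def
proof (intro ballI)
  fix y w assume y: "y \<in> Dstar q a" and w: "w \<in> Dstar q a"
  define Q where "Q = (\<lambda>y w. bracket a y w a + (ip a (schr q a y) w - ip a y (schr q a w)))"
  have Q0: "Q y y = 0" if "y \<in> Dstar q a" for y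
    unfolding Q_def by (rule bracket_vanishes_at_infinity[OF f g that])
  \<comment> \<open>Polarisation: the values 1 and \<open>\<i>\<close> of \<open>d\<close> separate the two mixed terms.\<close>
  have lin: "Q (\<lambda>x. 1 * y x + d * w x) (\<lambda>x. 1 * y x + d * w x) = Q y y + cnj d * Q y w + d * Q w y + d * cnj d * Q w w" for d
  proof -
    note v = Dstar_lincomb[OF y w, of 1 d]
    note Ly = DstarD(1)[OF y] and Lw = DstarD(1)[OF w] and Lv = DstarD(1)[OF v]
    have A: "ip a (schr q a (\<lambda>x. 1 * y x + d * w x)) (\<lambda>x. 1 * y x + d * w x)
      = ip a (schr q a y) y + cnj d * ip a (schr q a y) w + d * ip a (schr q a w) y + d * cnj d * ip a (schr q a w) w"
      unfolding ip_schr_lincomb[OF y w Lv]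
        ip_lincomb_right[OF Ly Lw DstarD(3)[OF y]] ip_lincomb_right[OF Ly Lw DstarD(3)[OF w]]
      by (simp add: algebra_simps)
    then have B: "ip a (\<lambda>x. 1 * y x + d * w x) (schr q a (\<lambda>x. 1 * y x + d * w x))
      = ip a y (schr q a y) + d * ip a w (schr q a y) + cnj d * ip a y (schr q a w) + d * cnj d * ip a w (schr q a w)"
      unfolding ip_cnj[of a _ "schr q a _"] by (simp add: algebra_simps)
    show ?thesis unfolding Q_def A B bracket_def D1_lincomb[OF y w] by (simp add: algebra_simps)
  qed
  have "cnj d * Q y w + d * Q w y = 0" for d
    using lin[of d] Q0[OF Dstar_lincomb[OF y w, of 1 d]] Q0[OF y] Q0[OF w] by simp
  from this[of 1] this[of \<i>] have "Q y w = 0" by (auto simp: complex_eq_iff)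
  then show "ip a (schr q a y) w - ip a y (schr q a w) = D1 a y a * cnj (w a) - y a * cnj (D1 a w a)"
    by (simp add: Q_def bracket_def algebra_simps eq_neg_iff_add_eq_0)
qed

section \<open>Weyl solutions\<close>

lemma norm_sq_zero_imp_zero:
  assumes f: "f \<in> L2 a" and c: "continuous_on {a..} f" and n: "norm_sq a f = 0" and x: "a \<le> x"
  shows "f x = 0"
proof -
  note sq = L2_square_integrable[OF f]
  have cx: "continuous_on {a..x+1} (\<lambda>x. (cmod (f x))\<^sup>2)"
    by (intro continuous_intros continuous_on_subset[OF c]) auto
  have si: "set_integrable lebesgue {a..x+1} (\<lambda>x. (cmod (f x))\<^sup>2)"
    by (rule set_integrable_subset[OF sq]) auto
  have "integral {a..x+1} (\<lambda>x. (cmod (f x))\<^sup>2) = (LINT x:{a..x+1}|lebesgue. (cmod (f x))\<^sup>2)"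
    by (rule set_lebesgue_integral_eq_integral(2)[OF si, symmetric])
  also have "\<dots> \<le> norm_sq a f"
    unfolding norm_sq_def set_lebesgue_integral_def
    by (rule integral_mono) (use sq si in \<open>auto simp: set_integrable_def indicator_def\<close>)
  finally have "integral {a..x+1} (\<lambda>x. (cmod (f x))\<^sup>2) \<le> 0" using n by simp
  moreover have "0 \<le> integral {a..x+1} (\<lambda>x. (cmod (f x))\<^sup>2)"
    by (rule Henstock_Kurzweil_Integration.integral_nonneg[OF integrable_continuous_real[OF cx]]) auto
  ultimately have "integral {a..x+1} (\<lambda>x. (cmod (f x))\<^sup>2) = 0" by simp
  then show ?thesis
    using integral_eq_0_iff[OF cx] x by auto
qed

text \<open>
  Otherwise \<open>f\<close> and \<open>g\<close> would be two elements of a one-dimensional space, and \<open>f(a) = 0 \<noteq> g(a)\<close> would force \<open>f = 0\<close>,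
  against \<open>f'(a) = 1\<close>.
\<close>

lemma defect_one_not_L2:
  assumes d: "defect q a z = 1"
    and f: "solves q a z f" "f a = 0" "D1 a f a = 1"
    and g: "solves q a z g" "g a = - 1" "g \<in> L2 a"
  shows "f \<notin> L2 a"
proof
  assume fL: "f \<in> L2 a"
  interpret vs: vector_space "\<lambda>c (f :: real \<Rightarrow> complex) x. c * f x"
    by standard (auto simp: algebra_simps fun_eq_iff)
  define V where "V = {y \<in> Dstar q a. solves q a z y}"
  obtain B where B: "B \<subseteq> V" "V \<subseteq> vs.span B" "card B = vs.dim V"
    using vs.basis_exists[of V] by metis
  then have "card B = 1" using d by (simp add: defect_def V_def)
  then obtain b where b: "B = {b}" by (metis card_1_singletonE)
  have "halfline a f \<in> V" "halfline a g \<in> V"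
    using solves_halfline[OF f(1) fL] solves_halfline[OF g(1,3)] by (auto simp: V_def)
  then have "halfline a f \<in> vs.span {b}" "halfline a g \<in> vs.span {b}" using B(2) b by auto
  then obtain c d where cd: "halfline a f = (\<lambda>x. c * b x)" "halfline a g = (\<lambda>x. d * b x)"
    unfolding vs.span_singleton by auto
  have f0: "c * b a = 0" using fun_cong[OF cd(1), of a] f(2) by (simp add: halfline_def)
  have g0: "d * b a = - 1" using fun_cong[OF cd(2), of a] g(2) by (simp add: halfline_def)
  have "c = 0" using f0 g0 by auto
  then have "halfline a f = (\<lambda>x. 0 * f x + 0 * f x)" using cd(1) by simp
  then have "D1 a (halfline a f) a = 0"
    using regular_lincomb(2)[of a f f a 0 0] f(1) by (simp add: solves_def)
  then show False using solves_halfline(4)[OF f(1) fL] f(3) by simp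
qed

text \<open>
  The number \<open>c\<close> is the value of the Weyl function at \<open>z\<close>: the combination \<open>\<phi>\<^sub>2 + c \<phi>\<^sub>1\<close> has value \<open>- 1\<close> and derivative \<open>c\<close>
  at the endpoint.
\<close>

definition weyl_solution :: "(real \<Rightarrow> real) \<Rightarrow> real \<Rightarrow> complex \<Rightarrow> complex \<Rightarrow> (real \<Rightarrow> complex) \<Rightarrow> bool" where
  "weyl_solution q a z c \<psi> \<longleftrightarrow> \<psi> \<in> Dstar q a \<and> solves q a z \<psi> \<and> \<psi> a = - 1 \<and> D1 a \<psi> a = c"

lemma limit_pointD:
  assumes "limit_point q a" "y \<in> Dstar q a" "w \<in> Dstar q a"
  shows "ip a (schr q a y) w - ip a y (schr q a w) = D1 a y a * cnj (w a) - y a * cnj (D1 a w a)"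
  using assms by (auto simp: limit_point_def)

lemma ip_solves_schr:
  assumes "y \<in> Dstar q a" "solves q a z y" "v \<in> L2 a"
  shows "ip a v (schr q a y) = cnj z * ip a v y"
  using ip_schr_solves[OF assms] by (metis complex_cnj_mult ip_cnj)

lemma weyl_solution_green:
  assumes lp: "limit_point q a" and y: "y \<in> Dstar q a" and chi: "weyl_solution q a z c \<psi>"
  shows "ip a (schr q a y) \<psi> = cnj z * ip a y \<psi> - D1 a y a - y a * cnj c"
  using limit_pointD[OF lp y, of \<psi>] chi ip_solves_schr[of \<psi> q a z y] DstarD(1)[OF y]
  by (auto simp: weyl_solution_def algebra_simps)

lemma weyl_solution_norm_pos:
  assumes "weyl_solution q a z c \<psi>"
  shows "norm_sq a \<psi> > 0"
proof -
  have D: "\<psi> \<in> Dstar q a" and a: "\<psi> a = - 1" using assms by (auto simp: weyl_solution_def)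
  have "norm_sq a \<psi> \<noteq> 0"
    using norm_sq_zero_imp_zero[OF DstarD(1)[OF D] ac_derivative_continuous_on[OF regularD(1)[OF DstarD(2)[OF D]]], of a] a
    by auto
  then show ?thesis using norm_sq_nonneg[of a \<psi>] by simp
qed

lemma weyl_function_Im:
  assumes lp: "limit_point q a" and chi: "weyl_solution q a z c \<psi>"
  shows "Im c = - Im z * norm_sq a \<psi>"
proof -
  have D: "\<psi> \<in> Dstar q a" "solves q a z \<psi>" "\<psi> a = - 1" "D1 a \<psi> a = c"
    using chi by (auto simp: weyl_solution_def)
  have "z * norm_sq a \<psi> = cnj z * norm_sq a \<psi> - c + cnj c"
    using weyl_solution_green[OF lp D(1) chi] ip_schr_solves[OF D(1,2) DstarD(1)[OF D(1)]] D
    by (simp add: ip_self)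
  from arg_cong[OF this, of Im] show ?thesis by simp
qed

lemma weyl_function_cnj:
  assumes lp: "limit_point q a" and chi: "weyl_solution q a z c \<psi>" and psi: "weyl_solution q a (cnj z) d \<theta>"
  shows "d = cnj c"
proof -
  have D: "\<psi> \<in> Dstar q a" "solves q a z \<psi>" "\<psi> a = - 1" "D1 a \<psi> a = c"
    using chi by (auto simp: weyl_solution_def)
  have P: "\<theta> \<in> L2 a" using psi by (auto simp: weyl_solution_def DstarD)
  have "cnj d = c"
    using weyl_solution_green[OF lp D(1) psi] ip_schr_solves[OF D(1,2) P] D by (simp add: algebra_simps)
  then show ?thesis by auto
qed

section \<open>The transfer function\<close>

text \<open>
  The boundary functional \<open>b\<close> is \<open>y \<mapsto> \<mu> y(a) - y'(a)\<close> for a finite parameter and \<open>y \<mapsto> y(a)\<close> for the infinite one. The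
  equation says \<open>(l(y) - z y, w) = \<gamma> cnj (b w)\<close> for all \<open>w\<close>, with a scalar \<open>\<gamma>\<close> that depends on the boundary values of
  \<open>y\<close>. For a multiple of the Weyl solution the left side is zero, and its factor is determined by \<open>\<gamma> = 0\<close>. For uniqueness,
  subtract from \<open>y\<close> the multiple of the Weyl solution that leaves \<open>y\<^sub>0\<close> with \<open>b y\<^sub>0 = 0\<close>, and test the equation with
  \<open>w = y\<^sub>0\<close> itself. The boundary condition \<open>b y\<^sub>0 = 0\<close> is self-adjoint, so \<open>(l(y\<^sub>0), y\<^sub>0)\<close> is real, whereas it equals
  \<open>z |y\<^sub>0|\<^sup>2\<close> with nonreal \<open>z\<close>; hence \<open>y\<^sub>0 = 0\<close>. Testing with \<open>w = y\<^sub>0\<close> replaces the density of the minimal domain.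
\<close>

lemma rank_one_resolvent:
  fixes b :: "(real \<Rightarrow> complex) \<Rightarrow> complex" and \<kappa> \<rho> :: complex
  assumes lp: "limit_point q a" and z: "Im z \<noteq> 0" and chi: "weyl_solution q a z c \<psi>"
    and lin: "\<And>y s. y \<in> Dstar q a \<Longrightarrow> b (\<lambda>x. 1 * y x + s * \<psi> x) = b y + s * b \<psi>"
    and scale: "\<And>s. b (\<lambda>x. s * \<psi> x) = s * b \<psi>"
    and sa: "\<And>y. y \<in> Dstar q a \<Longrightarrow> b y = 0 \<Longrightarrow> Im (D1 a y a * cnj (y a)) = 0"
    and b: "b \<psi> \<noteq> 0" and \<kappa>: "\<kappa> \<noteq> 0" and ch: "c + h \<noteq> 0"
  shows "(THE y. y \<in> Dstar q a \<and> (\<forall>w\<in>Dstar q a. ip a (schr q a y) w - \<kappa> * (D1 a y a - h * y a) * cnj (b w)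
      - z * ip a y w = \<rho> * cnj (b w))) = (\<lambda>x. - \<rho> / (\<kappa> * (c + h)) * \<psi> x)" (is "(THE y. ?P y) = _")
proof (rule the_equality)
  have D: "\<psi> \<in> Dstar q a" "solves q a z \<psi>" "\<psi> a = - 1" "D1 a \<psi> a = c"
    using chi by (auto simp: weyl_solution_def)
  have sD: "(\<lambda>x. s * \<psi> x) \<in> Dstar q a" for s using Dstar_lincomb[OF D(1) D(1), of s 0] by simp
  have sS: "solves q a z (\<lambda>x. s * \<psi> x)" for s using solves_lincomb[OF D(2) D(2), of s 0] by simp
  have sd: "D1 a (\<lambda>x. s * \<psi> x) a = s * c" for s using D1_lincomb[OF D(1) D(1), of s 0] D(4) by simp
  show "?P (\<lambda>x. - \<rho> / (\<kappa> * (c + h)) * \<psi> x)"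
  proof (intro conjI ballI sD)
    fix w assume w: "w \<in> Dstar q a"
    have e: "ip a (schr q a (\<lambda>x. s * \<psi> x)) w = z * ip a (\<lambda>x. s * \<psi> x) w" for s
      by (intro ip_schr_solves sD sS DstarD(1)[OF w])
    define s where "s = - \<rho> / (\<kappa> * (c + h))"
    have "- \<kappa> * (s * (c + h)) = \<rho>" using \<kappa> ch by (simp add: s_def)
    then have k: "- \<kappa> * (s * c - h * (s * - 1)) = \<rho>" by (simp add: algebra_simps)
    show "ip a (schr q a (\<lambda>x. - \<rho> / (\<kappa> * (c + h)) * \<psi> x)) w
        - \<kappa> * (D1 a (\<lambda>x. - \<rho> / (\<kappa> * (c + h)) * \<psi> x) a - h * (- \<rho> / (\<kappa> * (c + h)) * \<psi> a)) * cnj (b w)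
        - z * ip a (\<lambda>x. - \<rho> / (\<kappa> * (c + h)) * \<psi> x) w = \<rho> * cnj (b w)"
      unfolding sd D(3) s_def[symmetric] e unfolding k[symmetric] by simp
  qed
  fix y assume "?P y"
  then have y: "y \<in> Dstar q a" and eq: "\<And>w. w \<in> Dstar q a \<Longrightarrow> ip a (schr q a y) w
      - \<kappa> * (D1 a y a - h * y a) * cnj (b w) - z * ip a y w = \<rho> * cnj (b w)"
    by auto
  define s where "s = b y / b \<psi>"
  define y0 where "y0 = (\<lambda>x. 1 * y x + (- s) * \<psi> x)"
  have y0: "y0 \<in> Dstar q a" unfolding y0_def by (rule Dstar_lincomb[OF y D(1)])
  have b0: "b y0 = 0" unfolding y0_def lin[OF y] s_def using b by simp
  note L0 = DstarD(1)[OF y0]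
  have A1: "ip a (schr q a y0) y0 = 1 * ip a (schr q a y) y0 + (- s) * ip a (schr q a \<psi>) y0"
    by (subst (1) y0_def) (rule ip_schr_lincomb[OF y D(1) L0])
  have A2: "ip a y0 y0 = 1 * ip a y y0 + (- s) * ip a \<psi> y0"
    by (subst (1) y0_def) (rule ip_lincomb_left[OF DstarD(1)[OF y] DstarD(1)[OF D(1)] L0])
  have A3: "ip a (schr q a y) y0 = z * ip a y y0" using eq[OF y0] b0 by simp
  have A4: "ip a (schr q a \<psi>) y0 = z * ip a \<psi> y0" by (rule ip_schr_solves[OF D(1,2) L0])
  have E: "ip a (schr q a y0) y0 = z * norm_sq a y0"
    unfolding ip_self[symmetric] A1 A2 A3 A4 by (simp add: algebra_simps)
  have "Im (ip a (schr q a y0) y0) = Im (D1 a y0 a * cnj (y0 a))"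
    using arg_cong[OF limit_pointD[OF lp y0 y0], of Im] ip_cnj[of a y0 "schr q a y0"] by (simp add: algebra_simps)
  then have "Im z * norm_sq a y0 = 0" using E sa[OF y0 b0] by simp
  then have n0: "norm_sq a y0 = 0" using z by simp
  have "y0 x = 0" for x
  proof (cases "x < a")
    case True then show ?thesis using DstarD(4)[OF y0] by simp
  next
    case False
    then show ?thesis
      using norm_sq_zero_imp_zero[OF L0 ac_derivative_continuous_on[OF regularD(1)[OF DstarD(2)[OF y0]]] n0] by simp
  qed
  then have ys: "y = (\<lambda>x. s * \<psi> x)" by (auto simp: y0_def fun_eq_iff)
  have "ip a (schr q a y) \<psi> = z * ip a y \<psi>"
    unfolding ys by (rule ip_schr_solves[OF sD sS DstarD(1)[OF D(1)]])
  then have "- \<kappa> * (D1 a y a - h * y a) * cnj (b \<psi>) = \<rho> * cnj (b \<psi>)" using eq[OF D(1)] by simp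
  then have "- \<kappa> * (D1 a y a - h * y a) = \<rho>"
    using b by (metis complex_cnj_zero_iff mult_right_cancel)
  moreover have "D1 a y a - h * y a = s * (c + h)"
    using sd[of s] D(3) by (simp add: ys algebra_simps)
  ultimately have "- \<kappa> * (s * (c + h)) = \<rho>" by simp
  then have "\<rho> = - \<kappa> * (s * (c + h))" by simp
  then have "s * (\<kappa> * (c + h)) = - \<rho>" by (simp only:) (simp add: algebra_simps)
  then have "s = - \<rho> / (\<kappa> * (c + h))" using nonzero_eq_divide_eq \<kappa> ch by (metis mult_eq_0_iff)
  then show "y = (\<lambda>x. - \<rho> / (\<kappa> * (c + h)) * \<psi> x)" using ys by simp
qed

text \<open>
  The hypothesis \<open>Im z < 0\<close> gives \<open>Im c > 0\<close>, so that \<open>c + h\<close> and \<open>c + \<mu>\<close> do not vanish.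
\<close>

lemma transfer_function_eq:
  assumes lp: "limit_point q a" and z: "Im z < 0" and chi: "weyl_solution q a z c \<psi>" and h: "Im h > 0"
  shows "transfer_function q a \<mu> h z =
    (case \<mu> of Fin t \<Rightarrow> (of_real t - h) / (of_real t - cnj h) | Infty \<Rightarrow> 1) * ((c + cnj h) / (c + h))"
proof -
  have D: "\<psi> \<in> Dstar q a" "\<psi> a = - 1" "D1 a \<psi> a = c"
    using chi by (auto simp: weyl_solution_def)
  have Imc: "Im c > 0"
    using weyl_function_Im[OF lp chi] weyl_solution_norm_pos[OF chi] z by (simp add: mult_neg_pos)
  have ch: "c + h \<noteq> 0" using Imc h by (auto simp: complex_eq_iff)
  have sd: "D1 a (\<lambda>x. s * \<psi> x) a = s * c" for s using D1_lincomb[OF D(1) D(1), of s 0] D(3) by simp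
  have z0: "Im z \<noteq> 0" using z by simp
  have hh: "h - cnj h = 2 * \<i> * Im h" by (simp add: complex_eq_iff)
  show ?thesis
  proof (cases \<mu>)
    case (Fin t)
    define b where "b = (\<lambda>w. of_real t * w a - D1 a w a)"
    have th: "of_real t - h \<noteq> 0" "of_real t - cnj h \<noteq> 0" using h by (auto simp: complex_eq_iff)
    define \<rho> where "\<rho> = complex_of_real (sqrt (Im h) / cmod (complex_of_real t - h))"
    have cv: "channel_vec a \<mu> h w = \<rho> * cnj (b w)" for w
      by (simp add: channel_vec_def Fin \<rho>_def b_def delta_def delta'_def)
    have so: "state_op q a \<mu> h y w = ip a (schr q a y) w - 1 / (of_real t - h) * (D1 a y a - h * y a) * cnj (b w)" for y w
      by (simp add: state_op_def Fin b_def delta_def delta'_def)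
    have b\<psi>: "b \<psi> = - (of_real t + c)" by (simp add: b_def D)
    have R: "state_resolvent q a \<mu> h z (channel a \<mu> h 1) = (\<lambda>x. - \<rho> / (1 / (of_real t - h) * (c + h)) * \<psi> x)"
      unfolding state_resolvent_def so channel_def cv mult_1
    proof (rule rank_one_resolvent[OF lp z0 chi])
      show "b (\<lambda>x. 1 * y x + s * \<psi> x) = b y + s * b \<psi>" if "y \<in> Dstar q a" for y s
        unfolding b_def D1_lincomb[OF that D(1)] by (simp add: algebra_simps)
      show "b (\<lambda>x. s * \<psi> x) = s * b \<psi>" for s by (simp add: b_def sd D algebra_simps)
      show "Im (D1 a y a * cnj (y a)) = 0" if "b y = 0" for y
      proof -
        have "D1 a y a = of_real t * y a" using that by (simp add: b_def)
        then show ?thesis by simp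
      qed
      show "b \<psi> \<noteq> 0" using Imc by (auto simp: b\<psi> complex_eq_iff)
    qed (use th ch in auto)
    have "\<rho> * \<rho> = of_real (Im h) / (of_real ((cmod (of_real t - h))\<^sup>2))"
      using h by (simp add: \<rho>_def power2_eq_square flip: of_real_mult)
    also have "\<dots> = of_real (Im h) / ((of_real t - h) * (of_real t - cnj h))"
      unfolding complex_norm_square by simp
    finally have \<rho>2: "\<rho> * \<rho> = of_real (Im h) / ((of_real t - h) * (of_real t - cnj h))" .
    have "cnj \<rho> = \<rho>" by (simp add: \<rho>_def)
    then have ca: "channel_adj a \<mu> h (\<lambda>x. s * \<psi> x) = \<rho> * (s * b \<psi>)" for s
      unfolding channel_adj_def channel_def cv by (simp add: b_def sd D algebra_simps)
    have "channel_adj a \<mu> h (state_resolvent q a \<mu> h z (channel a \<mu> h 1))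
        = \<rho> * \<rho> * ((of_real t - h) * (of_real t + c) / (c + h))"
      unfolding R ca b\<psi> using th ch by (simp add: field_simps)
    also have "\<dots> = of_real (Im h) * (of_real t + c) / ((of_real t - cnj h) * (c + h))"
      unfolding \<rho>2 using th ch by simp
    finally have "transfer_function q a \<mu> h z
        = 1 - (h - cnj h) * (of_real t + c) / ((of_real t - cnj h) * (c + h))"
      unfolding transfer_function_def hh by simp
    also have "\<dots> = ((of_real t - cnj h) * (c + h) - (h - cnj h) * (of_real t + c)) / ((of_real t - cnj h) * (c + h))"
      using th ch by (simp add: diff_divide_distrib)
    also have "(of_real t - cnj h) * (c + h) - (h - cnj h) * (of_real t + c) = (of_real t - h) * (c + cnj h)"
      by (simp add: algebra_simps)
    also have "(of_real t - h) * (c + cnj h) / ((of_real t - cnj h) * (c + h))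
        = (of_real t - h) / (of_real t - cnj h) * ((c + cnj h) / (c + h))"
      by simp
    finally show ?thesis by (simp add: Fin)
  next
    case Infty
    define b where "b = (\<lambda>w::real \<Rightarrow> complex. w a)"
    define \<rho> where "\<rho> = complex_of_real (sqrt (Im h))"
    have cv: "channel_vec a \<mu> h w = \<rho> * cnj (b w)" for w
      by (simp add: channel_vec_def Infty \<rho>_def b_def delta_def)
    have so: "state_op q a \<mu> h y w = ip a (schr q a y) w - 1 * (D1 a y a - h * y a) * cnj (b w)" for y w
      by (simp add: state_op_def Infty b_def delta_def)
    have R: "state_resolvent q a \<mu> h z (channel a \<mu> h 1) = (\<lambda>x. - \<rho> / (1 * (c + h)) * \<psi> x)"
      unfolding state_resolvent_def so channel_def cv mult_1_left[of "\<rho> * _"]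
      by (rule rank_one_resolvent[OF lp z0 chi]) (use ch D in \<open>auto simp: b_def\<close>)
    have \<rho>2: "\<rho> * \<rho> = of_real (Im h)" using h by (simp add: \<rho>_def flip: of_real_mult)
    have "cnj \<rho> = \<rho>" by (simp add: \<rho>_def)
    then have ca: "channel_adj a \<mu> h (\<lambda>x. s * \<psi> x) = - \<rho> * s" for s
      unfolding channel_adj_def channel_def cv by (simp add: b_def D algebra_simps)
    have "channel_adj a \<mu> h (state_resolvent q a \<mu> h z (channel a \<mu> h 1)) = \<rho> * \<rho> / (c + h)"
      unfolding R ca by simp
    then have "transfer_function q a \<mu> h z = 1 - (h - cnj h) / (c + h)"
      unfolding transfer_function_def hh \<rho>2 by simp
    also have "\<dots> = (c + cnj h) / (c + h)" using ch by (simp add: field_simps)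
    finally show ?thesis by (simp add: Infty)
  qed
qed

lemma c_entropy_eq:
  assumes lp: "limit_point q a" and chi: "weyl_solution q a (- \<i>) (cnj c) \<psi>" and h: "Im h > 0"
  shows "c_entropy q a \<mu> h = (if h = - c then \<infinity> else ereal (- ln (cmod (c + h) / cmod (c + cnj h))))"
proof -
  have 1: "cmod (case \<mu> of Fin t \<Rightarrow> (of_real t - h) / (of_real t - cnj h) | Infty \<Rightarrow> 1) = 1"
  proof (cases \<mu>)
    case (Fin t)
    have "cmod (of_real t - cnj h) = cmod (cnj (of_real t - h))" by simp
    also have "\<dots> = cmod (of_real t - h)" by (rule complex_mod_cnj)
    finally have "cmod (of_real t - cnj h) = cmod (of_real t - h)" .
    moreover have "of_real t - h \<noteq> 0" using h by (auto simp: complex_eq_iff)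
    ultimately show ?thesis by (simp add: Fin norm_divide)
  qed simp
  have c1: "cmod (cnj c + cnj h) = cmod (c + h)" by (metis complex_cnj_add complex_mod_cnj)
  have c2: "cmod (cnj c + h) = cmod (c + cnj h)" by (metis complex_cnj_add complex_cnj_cnj complex_mod_cnj)
  have T: "cmod (transfer_function q a \<mu> h (- \<i>)) = cmod (c + h) / cmod (c + cnj h)"
    using transfer_function_eq[OF lp _ chi h, of \<mu>] 1 by (simp add: norm_mult norm_divide c1 c2)
  have "Im (cnj c) > 0"
    using weyl_function_Im[OF lp chi] weyl_solution_norm_pos[OF chi] by simp
  then have "c + cnj h \<noteq> 0" using h by (auto simp: complex_eq_iff)
  then have "transfer_function q a \<mu> h (- \<i>) = 0 \<longleftrightarrow> h = - c"
    using T by (metis (no_types) add.commute add_eq_0_iff divide_eq_0_iff norm_eq_zero)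
  then show ?thesis by (simp add: c_entropy_def T)
qed

section \<open>Test functions concentrated near the endpoint\<close>

lemma norm_sq_bounded_support:
  assumes c: "continuous_on {a..} f" and ab: "a \<le> b"
    and C: "\<And>x. a \<le> x \<Longrightarrow> x \<le> b \<Longrightarrow> cmod (f x) \<le> C" and z: "\<And>x. x > b \<Longrightarrow> f x = 0"
  shows "f \<in> L2 a" "norm_sq a f \<le> C\<^sup>2 * (b - a)"
proof -
  have f: "f = trunc b f" using z by (auto simp: trunc_def fun_eq_iff)
  show L: "f \<in> L2 a" using trunc_L2[OF c, of b] f by simp
  have i: "set_integrable lebesgue {a..b} (\<lambda>x. C\<^sup>2)"
    by (rule absolutely_integrable_on_const) auto
  have "norm_sq a f \<le> (LINT x:{a..b}|lebesgue. C\<^sup>2)"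
    unfolding norm_sq_def set_lebesgue_integral_def
  proof (rule integral_mono)
    show "integrable lebesgue (\<lambda>x. indicat_real {a..} x *\<^sub>R (cmod (f x))\<^sup>2)"
      using L2_square_integrable[OF L] by (simp add: set_integrable_def)
    show "integrable lebesgue (\<lambda>x. indicat_real {a..b} x *\<^sub>R C\<^sup>2)"
      using i by (simp add: set_integrable_def)
    fix x
    show "indicat_real {a..} x *\<^sub>R (cmod (f x))\<^sup>2 \<le> indicat_real {a..b} x *\<^sub>R C\<^sup>2"
      using C[of x] z[of x] by (auto simp: indicator_def not_le intro!: power_mono)
  qed
  also have "\<dots> = integral {a..b} (\<lambda>x. C\<^sup>2)"
    by (rule set_lebesgue_integral_eq_integral(2)[OF i])
  also have "\<dots> = C\<^sup>2 * (b - a)" using ab by simp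
  finally show "norm_sq a f \<le> C\<^sup>2 * (b - a)" .
qed

text \<open>
  Powers of \<open>max 0 (b - x)\<close> are glued at \<open>b\<close>; exponents from 2 on have a continuous derivative that is
  again of this kind.
\<close>

lemma positive_part_power_ac:
  fixes n :: nat
  shows "ac_derivative a (\<lambda>x. complex_of_real (max 0 (b - x) ^ Suc (Suc n)))
    (\<lambda>x. complex_of_real (- real (Suc (Suc n)) * max 0 (b - x) ^ Suc n))"
proof (rule ac_derivative_FTC[where S="{b}"])
  show "continuous_on {a..} (\<lambda>x. complex_of_real (max 0 (b - x) ^ Suc (Suc n)))"
    by (intro continuous_intros)
  show "locally_summable a (\<lambda>x. complex_of_real (- real (Suc (Suc n)) * max 0 (b - x) ^ Suc n))"
    by (intro locally_summable_continuous continuous_intros)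
  fix x assume "x \<notin> {b}"
  then consider "x < b" | "x > b" by force
  then show "((\<lambda>x. complex_of_real (max 0 (b - x) ^ Suc (Suc n))) has_vector_derivative
      complex_of_real (- real (Suc (Suc n)) * max 0 (b - x) ^ Suc n)) (at x)"
  proof cases
    case 1
    have "((\<lambda>x. (b - x) ^ Suc (Suc n)) has_real_derivative - real (Suc (Suc n)) * (b - x) ^ Suc n) (at x)"
    proof -
      have "((\<lambda>x. b - x) has_real_derivative - 1) (at x)" by (auto intro!: derivative_eq_intros)
      from DERIV_power[OF this, of "Suc (Suc n)"] show ?thesis by (simp del: power_Suc of_nat_Suc)
    qed
    then have "((\<lambda>x. complex_of_real ((b - x) ^ Suc (Suc n))) has_vector_derivative
        complex_of_real (- real (Suc (Suc n)) * (b - x) ^ Suc n)) (at x)"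
      by (intro has_vector_derivative_of_real) (simp add: has_real_derivative_iff_has_vector_derivative)
    then have "((\<lambda>x. complex_of_real (max 0 (b - x) ^ Suc (Suc n))) has_vector_derivative
        complex_of_real (- real (Suc (Suc n)) * (b - x) ^ Suc n)) (at x)"
      by (rule has_vector_derivative_transform_within_open[where S="{..<b}"]) (use 1 in auto)
    then show ?thesis using 1 by simp
  next
    case 2
    have "((\<lambda>x. 0::complex) has_vector_derivative 0) (at x)" by simp
    then have "((\<lambda>x. complex_of_real (max 0 (b - x) ^ Suc (Suc n))) has_vector_derivative 0) (at x)"
      by (rule has_vector_derivative_transform_within_open[where S="{b<..}"]) (use 2 in auto)
    then show ?thesis using 2 by simp
  qed
qed simp

text \<open>
  Take \<open>u = \<eta> \<phi>\<close> with \<open>\<eta> = ((a + t - x) / t)\<^sup>3\<close> on \<open>[a, a + t]\<close> and zero beyond. Since \<open>l(\<phi>) = 0\<close>, the locally summable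
  potential drops out of \<open>l(u) = - \<eta>'' \<phi> - 2 \<eta>' \<phi>'\<close>. On \<open>[a, a + t]\<close> one has \<open>\<phi> = O(t)\<close> as \<open>\<phi>(a) = 0\<close>, hence \<open>u = O(t)\<close> and
  \<open>l(u) = O(1/t)\<close>, and the energy \<open>(l(u), u)\<close> is \<open>O(t)\<close>. The cube makes \<open>\<eta>''\<close> continuous.
\<close>

lemma small_test_function:
  assumes f: "solves q a 0 \<phi>" "\<phi> a = 0" "D1 a \<phi> a = 1" and e: "e > 0"
  obtains u where "u \<in> Dstar q a" "u a = 0" "D1 a u a = 1" "norm_sq a u \<le> e"
    "cmod (ip a (schr q a u) u) \<le> e"
proof -
  have r: "regular a \<phi>" and ae: "AE x\<in>{a..} in lebesgue. schr q a \<phi> x = 0"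
    using f by (auto simp: solves_def)
  define \<phi>1 where "\<phi>1 = D1 a \<phi>"
  note ac = regularD[OF r, folded \<phi>1_def]
  note c0 = ac_derivative_continuous_on[OF ac(1)] and c1 = ac_derivative_continuous_on[OF ac(2)]
  have "bounded (\<phi>1 ` {a..a+1})"
    by (intro compact_imp_bounded compact_continuous_image continuous_on_subset[OF c1]) auto
  then obtain K0 where "\<forall>x\<in>\<phi>1 ` {a..a+1}. cmod x \<le> K0" unfolding bounded_iff by blast
  then have K0: "cmod (\<phi>1 x) \<le> K0" if "x \<in> {a..a+1}" for x using that by blast
  define K where "K = max 1 K0"
  have K: "K \<ge> 1" "\<And>x. a \<le> x \<Longrightarrow> x \<le> a + 1 \<Longrightarrow> cmod (\<phi>1 x) \<le> K"
    using K0 by (auto simp: K_def le_max_iff_disj)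
  have \<phi>K: "cmod (\<phi> x) \<le> K * (x - a)" if "a \<le> x" "x \<le> a + 1" for x
  proof -
    have "\<phi> x = integral {a..x} \<phi>1" using ac_derivative_eq[OF ac(1) that(1)] f(2) by simp
    then show ?thesis
      using integral_bound[OF that(1) continuous_on_subset[OF c1], of K] K(2) that by auto
  qed
  \<comment> \<open>The constant 12 bounds the energy: |l(u)| is at most 12 K / t and |u| at most K t on an interval of length t.\<close>
  define t where "t = min 1 (e / (12 * K\<^sup>2))"
  have t: "0 < t" "t \<le> 1" "12 * K\<^sup>2 * t \<le> e"
    using e K(1) by (auto simp: t_def min_def field_simps)
  define b where "b = a + t"
  define \<eta> where "\<eta> = (\<lambda>x. (1 / of_real (t ^ 3)) * complex_of_real (max 0 (b - x) ^ Suc (Suc 1)))"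
  define \<eta>1 where "\<eta>1 = (\<lambda>x. (- 3 / of_real (t ^ 3)) * complex_of_real (max 0 (b - x) ^ Suc (Suc 0)))"
  define \<eta>2 where "\<eta>2 = (\<lambda>x. (- 3 / of_real (t ^ 3)) * complex_of_real (- real (Suc (Suc 0)) * max 0 (b - x) ^ Suc 0))"
  have e1: "ac_derivative a \<eta> \<eta>1"
    by (rule ac_derivative_cong[OF ac_derivative_cmult[OF positive_part_power_ac[of a b 1], of "1 / of_real (t ^ 3)"]])
      (simp_all add: \<eta>_def \<eta>1_def)
  have e2: "ac_derivative a \<eta>1 \<eta>2"
    unfolding \<eta>1_def \<eta>2_def by (rule ac_derivative_cmult[OF positive_part_power_ac])
  define u where "u = (\<lambda>x. \<eta> x * \<phi> x)"
  define u1 where "u1 = (\<lambda>x. \<eta>1 x * \<phi> x + \<eta> x * \<phi>1 x)"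
  define g where "g = (\<lambda>x. - \<eta>2 x * \<phi> x - 2 * \<eta>1 x * \<phi>1 x)"
  have d1: "ac_derivative a u u1" unfolding u_def u1_def by (rule ac_derivative_mult[OF e1 ac(1)])
  have d2: "ac_derivative a u1 (\<lambda>x. (\<eta>2 x * \<phi> x + \<eta>1 x * \<phi>1 x) + (\<eta>1 x * \<phi>1 x + \<eta> x * D2 a \<phi> x))"
    unfolding u1_def
    by (rule ac_derivative_add[OF ac_derivative_mult[OF e2 ac(1)] ac_derivative_mult[OF e1 ac(2)]])
  note ru = regularI[OF d1 d2]
  have su: "AE x\<in>{a..} in lebesgue. g x = schr q a u x"
    using ru(3)[of q] ae
  proof eventually_elim
    case (elim x)
    show ?case
    proof
      assume x: "x \<in> {a..}"
      have "schr q a \<phi> x = 0" using elim(2) x by blast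
      then have D2: "D2 a \<phi> x = of_real (q x) * \<phi> x" by (simp add: schr_def)
      show "g x = schr q a u x"
        using elim(1) x by (simp only: D2) (simp add: g_def u_def algebra_simps)
    qed
  qed
  have ce: "continuous_on {a..} \<eta>2" unfolding \<eta>2_def by (intro continuous_intros)
  note cu = ac_derivative_continuous_on[OF d1]
  have cg: "continuous_on {a..} g"
    unfolding g_def
    by (intro continuous_intros ce c0 c1 ac_derivative_continuous_on[OF e2])
  have ab: "a \<le> b" "b \<le> a + 1" using t by (auto simp: b_def)
  have \<eta>b: "cmod (\<eta> x) \<le> 1" "cmod (\<eta>1 x) \<le> 3 / t" "cmod (\<eta>2 x) \<le> 6 / t\<^sup>2" if x: "a \<le> x" "x \<le> b" for x
  proof -
    have m: "0 \<le> max 0 (b - x)" "max 0 (b - x) \<le> t" using x by (auto simp: b_def)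
    have "max 0 (b - x) ^ Suc (Suc 1) \<le> t ^ 3"
      using power_mono[OF m(2,1), of 3] by (simp add: numeral_3_eq_3)
    then show "cmod (\<eta> x) \<le> 1"
      unfolding \<eta>_def using t m by (simp add: norm_mult norm_divide norm_power field_simps)
    have "max 0 (b - x) ^ Suc (Suc 0) \<le> t\<^sup>2" using power_mono[OF m(2,1), of 2] by (simp add: numeral_2_eq_2)
    then have "3 / t ^ 3 * max 0 (b - x) ^ Suc (Suc 0) \<le> 3 / t ^ 3 * t\<^sup>2"
      using t by (intro mult_left_mono) auto
    also have "\<dots> = 3 / t" using t by (simp add: power2_eq_square power3_eq_cube)
    also have "3 / t ^ 3 * max 0 (b - x) ^ Suc (Suc 0) = cmod (\<eta>1 x)"
      unfolding \<eta>1_def norm_mult norm_divide norm_of_real using t m by simp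
    finally show "cmod (\<eta>1 x) \<le> 3 / t" .
    have "3 / t ^ 3 * (2 * max 0 (b - x)) \<le> 3 / t ^ 3 * (2 * t)"
      using t m by (intro mult_left_mono) auto
    also have "\<dots> = 6 / t\<^sup>2" using t by (simp add: power2_eq_square power3_eq_cube)
    also have "3 / t ^ 3 * (2 * max 0 (b - x)) = cmod (\<eta>2 x)"
      unfolding \<eta>2_def norm_mult norm_divide norm_of_real using t m by simp
    finally show "cmod (\<eta>2 x) \<le> 6 / t\<^sup>2" .
  qed
  have \<phi>b: "cmod (\<phi> x) \<le> K * t" "cmod (\<phi>1 x) \<le> K" if x: "a \<le> x" "x \<le> b" for x
  proof -
    have "K * (x - a) \<le> K * t" using x K(1) by (intro mult_left_mono) (auto simp: b_def)
    then show "cmod (\<phi> x) \<le> K * t" using \<phi>K[of x] x ab by auto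
    show "cmod (\<phi>1 x) \<le> K" using K(2) x ab by auto
  qed
  have ub: "cmod (u x) \<le> K * t" if x: "a \<le> x" "x \<le> b" for x
    using mult_mono[OF \<eta>b(1)[OF x] \<phi>b(1)[OF x]] by (simp add: u_def norm_mult)
  have gb: "cmod (g x) \<le> 12 * K / t" if x: "a \<le> x" "x \<le> b" for x
  proof -
    have "cmod (g x) \<le> cmod (\<eta>2 x) * cmod (\<phi> x) + 2 * (cmod (\<eta>1 x) * cmod (\<phi>1 x))"
      unfolding g_def using norm_triangle_ineq4[of "- \<eta>2 x * \<phi> x" "2 * \<eta>1 x * \<phi>1 x"]
      by (simp add: norm_mult algebra_simps)
    also have "\<dots> \<le> 6 / t\<^sup>2 * (K * t) + 2 * (3 / t * K)"
      by (intro add_mono mult_mono \<eta>b[OF x] \<phi>b[OF x] mult_left_mono) (use t K in auto)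
    also have "\<dots> = 12 * K / t" using t by (simp add: field_simps power2_eq_square)
    finally show ?thesis .
  qed
  have z: "u x = 0" "g x = 0" if "x > b" for x
    using that by (auto simp: u_def g_def \<eta>_def \<eta>1_def \<eta>2_def)
  note nu = norm_sq_bounded_support[OF cu ab(1) ub z(1)]
  note ng = norm_sq_bounded_support[OF cg ab(1) gb z(2)]
  define v where "v = halfline a u"
  have sL: "schr q a u \<in> L2 a" by (rule L2_cong_AE[OF ng(1) su])
  have vD: "v \<in> Dstar q a" unfolding v_def by (rule halfline_Dstar[OF ru(1) nu(1) sL])
  have uv: "AE x\<in>{a..} in lebesgue. u x = v x" by (simp add: v_def halfline_def)
  have gv: "AE x\<in>{a..} in lebesgue. g x = schr q a v x"
    using su regular_halfline(3)[OF ru(1), of q] by eventually_elim (auto simp: v_def)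
  show thesis
  proof
    show "v \<in> Dstar q a" by (rule vD)
    show "v a = 0" using f(2) by (simp add: v_def halfline_def u_def)
    have "\<eta> a = 1" using t by (simp add: \<eta>_def b_def power3_eq_cube)
    moreover have "D1 a v a = u1 a"
      unfolding v_def using regular_halfline(2)[OF ru(1), of a] ru(2)[of a] by simp
    ultimately show "D1 a v a = 1" using f by (simp add: u1_def \<phi>1_def)
    have nv: "norm_sq a v = norm_sq a u"
      unfolding norm_sq_def v_def set_lebesgue_integral_def
      by (intro arg_cong[where f="integral\<^sup>L lebesgue"]) (auto simp: halfline_def indicator_def)
    have n1: "norm_sq a v \<le> (K * t)\<^sup>2 * t" using nu(2) nv by (simp add: b_def)
    also have "\<dots> \<le> K\<^sup>2 * t"
      using t K by (simp add: power_mult_distrib power_le_one mult_left_le)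
    also have "\<dots> \<le> 12 * K\<^sup>2 * t" using t(1) by simp
    also note t(3)
    finally show "norm_sq a v \<le> e" .
    have "ip a (schr q a v) v = ip a g v" by (rule ip_cong_AE[OF ng(1) DstarD(1)[OF vD] gv, symmetric])
    then have "(cmod (ip a (schr q a v) v))\<^sup>2 \<le> norm_sq a g * norm_sq a v"
      using ip_Cauchy_Schwarz[OF ng(1) DstarD(1)[OF vD]] by simp
    also have "\<dots> \<le> ((12 * K / t)\<^sup>2 * t) * ((K * t)\<^sup>2 * t)"
      using ng(2) n1 norm_sq_nonneg[of a v] t by (intro mult_mono) (auto simp: b_def)
    also have "\<dots> = (12 * K\<^sup>2 * t)\<^sup>2" using t by (simp add: power2_eq_square field_simps)
    finally have "cmod (ip a (schr q a v) v) \<le> 12 * K\<^sup>2 * t"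
      by (rule power2_le_imp_le) (use t K in auto)
    then show "cmod (ip a (schr q a v) v) \<le> e" using t(3) by simp
  qed
qed

text \<open>
  Subtracting \<open>y'(a) u\<close> with a small test function \<open>u\<close> moves \<open>y\<close> into the minimal domain, where the form is
  nonnegative; the error is controlled by the norm and the energy of \<open>u\<close>, because \<open>(l(u), y) = (u, l(y))\<close> when both
  functions vanish at the endpoint.
\<close>

lemma dirichlet_nonneg:
  assumes lp: "limit_point q a" and f: "solves q a 0 \<phi>" "\<phi> a = 0" "D1 a \<phi> a = 1"
    and nn: "nonnegative a (Dmin q a) (schr q a)"
    and y: "y \<in> Dstar q a" and y0: "y a = 0"
  shows "0 \<le> Re (ip a (schr q a y) y)"
proof -
  define s where "s = D1 a y a"
  define N where "N = norm_sq a (schr q a y)"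
  have N: "N \<ge> 0" by (simp add: N_def norm_sq_nonneg)
  have *: "- (2 * cmod s * sqrt (N * e) + (cmod s)\<^sup>2 * e) \<le> Re (ip a (schr q a y) y)" if e: "e > 0" for e
  proof -
    from small_test_function[OF f e] obtain u where u: "u \<in> Dstar q a" "u a = 0" "D1 a u a = 1"
      "norm_sq a u \<le> e" "cmod (ip a (schr q a u) u) \<le> e" by metis
    define v where "v = (\<lambda>x. 1 * y x + (- s) * u x)"
    have vD: "v \<in> Dstar q a" unfolding v_def by (rule Dstar_lincomb[OF y u(1)])
    have "v \<in> Dmin q a"
      using vD D1_lincomb[OF y u(1), of 1 "-s"] y0 u by (simp add: Dmin_def v_def s_def)
    then have "ip a (schr q a v) v \<in> \<real>\<^sub>\<ge>\<^sub>0" using nn by (simp add: nonnegative_def)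
    then have pos: "0 \<le> Re (ip a (schr q a v) v)" by (auto simp: nonneg_Reals_def)
    note Ly = DstarD(1)[OF y] and Lu = DstarD(1)[OF u(1)] and Lv = DstarD(1)[OF vD]
    define p where "p = ip a (schr q a y) u"
    have "ip a (schr q a u) y = ip a u (schr q a y)"
      using limit_pointD[OF lp u(1) y] u(2) y0 by simp
    then have cr: "ip a (schr q a u) y = cnj p" by (simp add: p_def ip_cnj[of a u "schr q a y"])
    have "ip a (schr q a v) v = 1 * ip a (schr q a y) v + (- s) * ip a (schr q a u) v"
      by (subst (1) v_def) (rule ip_schr_lincomb[OF y u(1) Lv])
    also have "ip a (schr q a y) v = cnj 1 * ip a (schr q a y) y + cnj (- s) * p"
      unfolding v_def p_def by (rule ip_lincomb_right[OF Ly Lu DstarD(3)[OF y]])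
    also have "ip a (schr q a u) v = cnj 1 * cnj p + cnj (- s) * ip a (schr q a u) u"
      unfolding v_def cr[symmetric] by (rule ip_lincomb_right[OF Ly Lu DstarD(3)[OF u(1)]])
    finally have "ip a (schr q a v) v = ip a (schr q a y) y - (cnj s * p + cnj (cnj s * p)) + (s * cnj s) * ip a (schr q a u) u"
      by (simp add: algebra_simps)
    then have "Re (ip a (schr q a v) v) = Re (ip a (schr q a y) y) - 2 * Re (cnj s * p) + (cmod s)\<^sup>2 * Re (ip a (schr q a u) u)"
      unfolding complex_add_cnj complex_norm_square[symmetric] by simp
    moreover have "(cmod s)\<^sup>2 * Re (ip a (schr q a u) u) \<le> (cmod s)\<^sup>2 * e"
      using u(5) complex_Re_le_cmod[of "ip a (schr q a u) u"] by (intro mult_left_mono) auto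
    moreover have "- Re (cnj s * p) \<le> cmod s * sqrt (N * e)"
    proof -
      have "(cmod p)\<^sup>2 \<le> N * norm_sq a u"
        unfolding p_def N_def by (rule ip_Cauchy_Schwarz[OF DstarD(3)[OF y] Lu])
      also have "\<dots> \<le> N * e" using u(4) N by (intro mult_left_mono)
      finally have "cmod p \<le> sqrt (N * e)" by (simp add: real_le_rsqrt)
      then have "cmod s * cmod p \<le> cmod s * sqrt (N * e)" by (intro mult_left_mono) auto
      moreover have "- Re (cnj s * p) \<le> cmod (cnj s * p)" using abs_Re_le_cmod[of "cnj s * p"] by linarith
      ultimately show ?thesis by (simp add: norm_mult)
    qed
    ultimately show ?thesis using pos by simp
  qed
  have "((\<lambda>e. - (2 * cmod s * sqrt (N * e) + (cmod s)\<^sup>2 * e)) \<longlongrightarrow> - (2 * cmod s * sqrt (N * 0) + (cmod s)\<^sup>2 * 0)) (at_right 0)"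
    by (intro tendsto_intros)
  then show ?thesis
    using tendsto_upperbound[of _ _ "at_right (0::real)" "Re (ip a (schr q a y) y)"] *
    by (auto simp: eventually_at_right_less intro!: eventually_mono[OF eventually_at_right_less[of 0]])
qed

section \<open>Extremal accretivity\<close>

text \<open>
  Since \<open>l(\<psi>) = t \<psi>\<close> with real \<open>t\<close>, Green's identity turns the mixed terms of \<open>((l - t) y, y)\<close> into the boundary
  term \<open>cnj s y\<^sub>0'(a)\<close>.
\<close>

lemma form_decomposition:
  fixes t :: real
  assumes lp: "limit_point q a" and psi: "weyl_solution q a t c \<psi>"
    and y0: "y0 \<in> Dstar q a" "y0 a = 0" and y: "y = (\<lambda>x. 1 * y0 x + (- s) * \<psi> x)"
  shows "ip a (schr q a y) y = t * norm_sq a y + (ip a (schr q a y0) y0 - t * norm_sq a y0) + cnj s * D1 a y0 a"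
proof -
  have D: "\<psi> \<in> Dstar q a" "solves q a t \<psi>" using psi by (auto simp: weyl_solution_def)
  have yD: "y \<in> Dstar q a" unfolding y by (rule Dstar_lincomb[OF y0(1) D(1)])
  note L0 = DstarD(1)[OF y0(1)] and L1 = DstarD(1)[OF D(1)] and L = DstarD(1)[OF yD]
  have 1: "ip a (schr q a y) y = 1 * ip a (schr q a y0) y + (- s) * ip a (schr q a \<psi>) y"
    by (subst (1) y) (rule ip_schr_lincomb[OF y0(1) D(1) L])
  have 2: "ip a (schr q a \<psi>) y = t * ip a \<psi> y" by (rule ip_schr_solves[OF D L])
  have 3: "ip a (schr q a y0) y = cnj 1 * ip a (schr q a y0) y0 + cnj (- s) * ip a (schr q a y0) \<psi>"
    unfolding y by (rule ip_lincomb_right[OF L0 L1 DstarD(3)[OF y0(1)]])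
  have 4: "ip a (schr q a y0) \<psi> = t * ip a y0 \<psi> - D1 a y0 a"
    using weyl_solution_green[OF lp y0(1) psi] y0(2) by simp
  have 5: "ip a y y = 1 * ip a y0 y + (- s) * ip a \<psi> y"
    by (subst (1) y) (rule ip_lincomb_left[OF L0 L1 L])
  have 6: "ip a y0 y = cnj 1 * ip a y0 y0 + cnj (- s) * ip a y0 \<psi>"
    unfolding y by (rule ip_lincomb_right[OF L0 L1 L0])
  show ?thesis
    unfolding of_real_mult ip_self[symmetric] 1 2 3 4 unfolding 5 6 by (simp add: algebra_simps)
qed

lemma form_Im:
  assumes lp: "limit_point q a" and y: "y \<in> dom_T q a h"
  shows "Im (ip a (schr q a y) y) = Im h * (cmod (y a))\<^sup>2"
proof -
  have D: "y \<in> Dstar q a" "D1 a y a = h * y a" using y by (auto simp: dom_T_def)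
  have "ip a (schr q a y) y - cnj (ip a (schr q a y) y) = (h - cnj h) * (y a * cnj (y a))"
    using limit_pointD[OF lp D(1) D(1)] D(2) by (simp add: ip_cnj[of a y "schr q a y"] algebra_simps)
  then show ?thesis
    unfolding complex_norm_square[symmetric] complex_diff_cnj by (simp add: complex_eq_iff)
qed

text \<open>
  In the decomposition \<open>y = y\<^sub>0 - y(a) \<psi>\<close> the boundary condition gives \<open>y\<^sub>0'(a) = (h + M(t)) y(a)\<close>, so the boundary term
  is \<open>(h + M(t)) |y(a)|\<^sup>2\<close>. The Dirichlet part is nonnegative, and \<open>t\<close> tends to \<open>0\<close> from below.
\<close>

lemma form_lower_bound:
  fixes M :: "real \<Rightarrow> complex" and m :: real
  assumes lp: "limit_point q a" and f: "solves q a 0 \<phi>" "\<phi> a = 0" "D1 a \<phi> a = 1"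
    and nn: "nonnegative a (Dmin q a) (schr q a)"
    and psi: "\<And>t. t < 0 \<Longrightarrow> weyl_solution q a (complex_of_real t) (M t) (\<psi> t)"
    and m: "(M \<longlongrightarrow> complex_of_real m) (at_left 0)"
    and y: "y \<in> dom_T q a h"
  shows "(Re h + m) * (cmod (y a))\<^sup>2 \<le> Re (ip a (schr q a y) y)"
proof -
  have D: "y \<in> Dstar q a" "D1 a y a = h * y a" using y by (auto simp: dom_T_def)
  have *: "t * norm_sq a y + (Re h + Re (M t)) * (cmod (y a))\<^sup>2 \<le> Re (ip a (schr q a y) y)" if t: "t < 0" for t
  proof -
    have P: "\<psi> t \<in> Dstar q a" "\<psi> t a = - 1" "D1 a (\<psi> t) a = M t"
      using psi[OF t] by (auto simp: weyl_solution_def)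
    define y0 where "y0 = (\<lambda>x. 1 * y x + y a * \<psi> t x)"
    have y0: "y0 \<in> Dstar q a" unfolding y0_def by (rule Dstar_lincomb[OF D(1) P(1)])
    have y0a: "y0 a = 0" by (simp add: y0_def P)
    have d0: "D1 a y0 a = (h + M t) * y a"
      unfolding y0_def D1_lincomb[OF D(1) P(1)] using D P by (simp add: algebra_simps)
    have "y = (\<lambda>x. 1 * y0 x + (- y a) * \<psi> t x)" by (simp add: y0_def)
    from form_decomposition[OF lp psi[OF t] y0 y0a this]
    have "ip a (schr q a y) y = t * norm_sq a y + (ip a (schr q a y0) y0 - t * norm_sq a y0) + (h + M t) * (y a * cnj (y a))"
      by (simp add: d0 algebra_simps)
    then have "Re (ip a (schr q a y) y) = t * norm_sq a y + (Re (ip a (schr q a y0) y0) - t * norm_sq a y0)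
        + (Re h + Re (M t)) * (cmod (y a))\<^sup>2"
      unfolding complex_norm_square[symmetric] by simp
    moreover have "0 \<le> Re (ip a (schr q a y0) y0)" by (rule dirichlet_nonneg[OF lp f nn y0 y0a])
    moreover have "t * norm_sq a y0 \<le> 0" using t norm_sq_nonneg[of a y0] by (simp add: mult_nonpos_nonneg)
    ultimately show ?thesis by simp
  qed
  have "((\<lambda>t. t * norm_sq a y + (Re h + Re (M t)) * (cmod (y a))\<^sup>2) \<longlongrightarrow>
      0 * norm_sq a y + (Re h + Re (complex_of_real m)) * (cmod (y a))\<^sup>2) (at_left 0)"
    by (intro tendsto_intros m)
  then have "0 * norm_sq a y + (Re h + Re (complex_of_real m)) * (cmod (y a))\<^sup>2 \<le> Re (ip a (schr q a y) y)"
    by (rule tendsto_upperbound)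
      (auto intro!: eventually_mono[OF eventually_at_left_real[of "-1" 0]] *)
  then show ?thesis by simp
qed

text \<open>
  With \<open>t\<close> so close to \<open>0\<close> that \<open>M(t)\<close> is near \<open>m\<close>, the function \<open>(h + M(t)) u - \<psi>\<close> satisfies the boundary condition, and
  a small test function \<open>u\<close> makes its Dirichlet part negligible.
\<close>

lemma form_almost_attained:
  fixes M :: "real \<Rightarrow> complex" and m :: real
  assumes lp: "limit_point q a" and f: "solves q a 0 \<phi>" "\<phi> a = 0" "D1 a \<phi> a = 1"
    and psi: "\<And>t. t < 0 \<Longrightarrow> weyl_solution q a (complex_of_real t) (M t) (\<psi> t)"
    and m: "(M \<longlongrightarrow> complex_of_real m) (at_left 0)" and e: "e > 0"
  obtains y where "y \<in> dom_T q a h" "y a = 1" "Re (ip a (schr q a y) y) \<le> Re h + m + e"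
proof -
  have "((\<lambda>t. Re (M t)) \<longlongrightarrow> Re (complex_of_real m)) (at_left 0)" by (intro tendsto_intros m)
  then have "\<forall>\<^sub>F t in at_left 0. Re (M t) < m + e / 2"
    by (rule order_tendstoD) (use e in simp)
  moreover have "\<forall>\<^sub>F t in at_left 0. t \<in> {-1<..<0::real}" by (rule eventually_at_left_real) simp
  ultimately have "\<forall>\<^sub>F t in at_left 0. Re (M t) < m + e / 2 \<and> t \<in> {-1<..<0}" by (rule eventually_conj)
  then obtain t where t: "Re (M t) < m + e / 2" "-1 < t" "t < 0"
    using eventually_happens'[of "at_left (0::real)"] by (metis (mono_tags, lifting) greaterThanLessThan_iff trivial_limit_at_left_real)
  have P: "\<psi> t \<in> Dstar q a" "\<psi> t a = - 1" "D1 a (\<psi> t) a = M t"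
    using psi[OF t(3)] by (auto simp: weyl_solution_def)
  define k where "k = h + M t"
  define r where "r = e / (4 * ((cmod k)\<^sup>2 + 1))"
  have k1: "(cmod k)\<^sup>2 + 1 > 0" by (simp add: add_nonneg_pos)
  have r: "r > 0" using e k1 by (simp add: r_def)
  from small_test_function[OF f r] obtain u where u: "u \<in> Dstar q a" "u a = 0" "D1 a u a = 1"
    "norm_sq a u \<le> r" "cmod (ip a (schr q a u) u) \<le> r" by metis
  define y0 where "y0 = (\<lambda>x. k * u x + 0 * u x)"
  have y0: "y0 \<in> Dstar q a" unfolding y0_def by (rule Dstar_lincomb[OF u(1) u(1)])
  have y0a: "y0 a = 0" by (simp add: y0_def u)
  have d0: "D1 a y0 a = k" unfolding y0_def D1_lincomb[OF u(1) u(1)] using u by simp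
  define y where "y = (\<lambda>x. 1 * y0 x + (- 1) * \<psi> t x)"
  have yD: "y \<in> Dstar q a" unfolding y_def by (rule Dstar_lincomb[OF y0 P(1)])
  have ya: "y a = 1" by (simp add: y_def y0a P)
  have dy: "D1 a y a = h" unfolding y_def D1_lincomb[OF y0 P(1)] by (simp add: d0 P k_def)
  have "ip a (schr q a y0) y0 = k * ip a (schr q a u) y0"
    using ip_schr_lincomb[OF u(1) u(1) DstarD(1)[OF y0], of k 0] by (simp add: y0_def)
  also have "ip a (schr q a u) y0 = cnj k * ip a (schr q a u) u"
    using ip_lincomb_right[OF DstarD(1)[OF u(1)] DstarD(1)[OF u(1)] DstarD(3)[OF u(1)], of k 0] by (simp add: y0_def)
  finally have q0: "ip a (schr q a y0) y0 = complex_of_real ((cmod k)\<^sup>2) * ip a (schr q a u) u"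
    unfolding complex_norm_square by simp
  have n0: "norm_sq a y0 = (cmod k)\<^sup>2 * norm_sq a u"
    unfolding y0_def norm_sq_lincomb[OF DstarD(1)[OF u(1)] DstarD(1)[OF u(1)]] by simp
  have E: "ip a (schr q a y) y = t * norm_sq a y + (ip a (schr q a y0) y0 - t * norm_sq a y0) + k"
    using form_decomposition[OF lp psi[OF t(3)] y0 y0a y_def] by (simp add: d0)
  have "Re (complex_of_real ((cmod k)\<^sup>2) * w) = (cmod k)\<^sup>2 * Re w" for w
    by (simp del: of_real_power)
  with arg_cong[OF E, of Re] have "Re (ip a (schr q a y) y) = t * norm_sq a y + (cmod k)\<^sup>2 * (Re (ip a (schr q a u) u) - t * norm_sq a u) + Re k"
    unfolding q0 n0 by (simp add: algebra_simps)
  also have "\<dots> \<le> 0 + (cmod k)\<^sup>2 * (2 * r) + Re k"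
  proof (intro add_mono mult_left_mono)
    show "t * norm_sq a y \<le> 0" using t norm_sq_nonneg[of a y] by (simp add: mult_nonpos_nonneg)
    have "- t * norm_sq a u \<le> 1 * r" using t u(4) norm_sq_nonneg[of a u] by (intro mult_mono) auto
    then show "Re (ip a (schr q a u) u) - t * norm_sq a u \<le> 2 * r"
      using u(5) complex_Re_le_cmod[of "ip a (schr q a u) u"] by simp
  qed auto
  also have "(cmod k)\<^sup>2 * (2 * r) \<le> e / 2"
    using e k1 by (simp add: r_def field_simps)
  finally have "Re (ip a (schr q a y) y) \<le> e / 2 + Re k" by simp
  then have "Re (ip a (schr q a y) y) \<le> Re h + m + e" using t(1) by (simp add: k_def)
  then show thesis using that[of y] yD ya dy by (simp add: dom_T_def)
qed

text \<open>
  On the domain of \<open>T\<^sub>h\<close> the imaginary part of the form is \<open>Im h |y(a)|\<^sup>2\<close> and the real part has the sharp lower bound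
  \<open>(Re h + m) |y(a)|\<^sup>2\<close>; so an angle \<open>\<alpha>\<close> of sectoriality is admissible exactly when \<open>cot \<alpha> \<le> (Re h + m) / Im h\<close>.
\<close>

lemma extremal_accretive_iff:
  fixes M :: "real \<Rightarrow> complex" and m :: real
  assumes lp: "limit_point q a" and f: "solves q a 0 \<phi>" "\<phi> a = 0" "D1 a \<phi> a = 1"
    and nn: "nonnegative a (Dmin q a) (schr q a)"
    and psi: "\<And>t. t < 0 \<Longrightarrow> weyl_solution q a (complex_of_real t) (M t) (\<psi> t)"
    and m: "(M \<longlongrightarrow> complex_of_real m) (at_left 0)" and h: "Im h > 0"
  shows "extremal_accretive a (dom_T q a h) (schr q a) \<longleftrightarrow> Re h = - m"
proof -
  note low = form_lower_bound[OF lp f nn psi m]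
  have imf: "\<bar>Im (ip a (schr q a y) y)\<bar> = Im h * (cmod (y a))\<^sup>2" if "y \<in> dom_T q a h" for y
    using form_Im[OF lp that] h by (simp add: abs_mult)
  consider "Re h < - m" | "Re h > - m" | "Re h = - m" by linarith
  then show ?thesis
  proof cases
    case 1
    obtain y where y: "y \<in> dom_T q a h" "Re (ip a (schr q a y) y) \<le> Re h + m + (- (Re h + m)) / 2"
      using form_almost_attained[OF lp f psi m, of "(- (Re h + m)) / 2" h] 1 by auto
    note y(2)
    also have "Re h + m + (- (Re h + m)) / 2 = (Re h + m) / 2" by (simp add: field_simps)
    also have "\<dots> < 0" using 1 by simp
    finally have "Re (ip a (schr q a y) y) < 0" .
    then have "\<not> accretive a (dom_T q a h) (schr q a)"
      using y(1) by (force simp: accretive_def)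
    then show ?thesis using 1 by (simp add: extremal_accretive_def)
  next
    case 2
    define s where "s = Im h / (Re h + m)"
    have s: "s > 0" using 2 h by (simp add: s_def)
    have "cot (arctan s) = (Re h + m) / Im h"
      by (simp add: cot_altdef tan_arctan s_def)
    then have "sectorial (arctan s) a (dom_T q a h) (schr q a)"
      using low imf h by (auto simp: sectorial_def)
    moreover have "0 < arctan s" "arctan s < pi / 2" using s arctan_ubound by auto
    ultimately show ?thesis using 2 by (auto simp: extremal_accretive_def)
  next
    case 3
    have "accretive a (dom_T q a h) (schr q a)"
      using low 3 by (force simp: accretive_def)
    moreover have False if al: "0 < \<alpha>" "\<alpha> < pi / 2" "sectorial \<alpha> a (dom_T q a h) (schr q a)" for \<alpha>
    proof -
      have "cot \<alpha> > 0" using al(1,2) by (simp add: cot_def sin_gt_zero cos_gt_zero)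
      then have e: "cot \<alpha> * Im h / 2 > 0" using h by simp
      from form_almost_attained[OF lp f psi m e, of h] obtain y where
        y: "y \<in> dom_T q a h" "y a = 1" "Re (ip a (schr q a y) y) \<le> Re h + m + cot \<alpha> * Im h / 2" by metis
      have "cot \<alpha> * Im h \<le> Re (ip a (schr q a y) y)"
        using al(3) y(1,2) imf[OF y(1)] by (force simp: sectorial_def)
      then show False using y(3) 3 e by simp
    qed
    ultimately show ?thesis using 3 by (auto simp: extremal_accretive_def)
  qed
qed

section \<open>Maximising the entropy\<close>

text \<open>
  The ratio is the squared modulus of the transfer function at \<open>- \<i>\<close> on the line \<open>Re h = - m\<close>, with \<open>v = Im h\<close>. Since
  \<open>d\<^sup>2 + B\<^sup>2 = s\<^sup>2\<close>, it exceeds \<open>(s - B) / (s + B)\<close> by a positive multiple of \<open>(v - s)\<^sup>2\<close>.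
\<close>

lemma entropy_ratio_min:
  fixes d B v :: real
  assumes d: "d \<noteq> 0" and B: "B > 0" and v: "v > 0"
  defines "s \<equiv> sqrt (d\<^sup>2 + B\<^sup>2)"
  shows "(s - B) / (s + B) \<le> (d\<^sup>2 + (v - B)\<^sup>2) / (d\<^sup>2 + (v + B)\<^sup>2)"
    and "(s - B) / (s + B) = (d\<^sup>2 + (v - B)\<^sup>2) / (d\<^sup>2 + (v + B)\<^sup>2) \<longleftrightarrow> v = s"
    and "0 < (s - B) / (s + B)" and "B < s"
proof -
  have d2: "d\<^sup>2 > 0" using d by simp
  have s2: "s\<^sup>2 = d\<^sup>2 + B\<^sup>2" by (simp add: s_def)
  have "sqrt (B\<^sup>2) < s" unfolding s_def using d2 by (intro real_sqrt_less_mono) simp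
  then show sB: "B < s" using B by simp
  then show "0 < (s - B) / (s + B)" using B by simp
  have p1: "s + B > 0" using sB B by simp
  have p2: "d\<^sup>2 + (v + B)\<^sup>2 > 0" using d2 by (simp add: add_pos_nonneg)
  have diff: "(d\<^sup>2 + (v - B)\<^sup>2) / (d\<^sup>2 + (v + B)\<^sup>2) - (s - B) / (s + B)
      = 2 * B * (v - s)\<^sup>2 / ((d\<^sup>2 + (v + B)\<^sup>2) * (s + B))"
  proof -
    have "(d\<^sup>2 + (v - B)\<^sup>2) * (s + B) - (s - B) * (d\<^sup>2 + (v + B)\<^sup>2) = 2 * B * (d\<^sup>2 + B\<^sup>2 + v\<^sup>2) - 4 * s * v * B"
      by (simp add: power2_eq_square algebra_simps)
    also have "\<dots> = 2 * B * (v - s)\<^sup>2" unfolding s2[symmetric] by (simp add: power2_eq_square algebra_simps)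
    finally have n: "(d\<^sup>2 + (v - B)\<^sup>2) * (s + B) - (s - B) * (d\<^sup>2 + (v + B)\<^sup>2) = 2 * B * (v - s)\<^sup>2" .
    show ?thesis unfolding n[symmetric] by (rule diff_frac_eq) (use p1 p2 in auto)
  qed
  have "0 \<le> 2 * B * (v - s)\<^sup>2 / ((d\<^sup>2 + (v + B)\<^sup>2) * (s + B))"
    using B p1 p2 by (intro divide_nonneg_pos mult_pos_pos) auto
  then show "(s - B) / (s + B) \<le> (d\<^sup>2 + (v - B)\<^sup>2) / (d\<^sup>2 + (v + B)\<^sup>2)" using diff by linarith
  have "(s - B) / (s + B) = (d\<^sup>2 + (v - B)\<^sup>2) / (d\<^sup>2 + (v + B)\<^sup>2)
      \<longleftrightarrow> 2 * B * (v - s)\<^sup>2 / ((d\<^sup>2 + (v + B)\<^sup>2) * (s + B)) = 0"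
    using diff by linarith
  also have "\<dots> \<longleftrightarrow> v = s" using B p1 p2 d by simp
  finally show "(s - B) / (s + B) = (d\<^sup>2 + (v - B)\<^sup>2) / (d\<^sup>2 + (v + B)\<^sup>2) \<longleftrightarrow> v = s" .
qed

theorem theorem25:
  fixes q :: "real \<Rightarrow> real" and a :: real
    and \<phi>1 \<phi>2 :: "complex \<Rightarrow> real \<Rightarrow> complex"
    and M :: "complex \<Rightarrow> complex"
    and A B m :: real
  assumes q: "locally_summable a q"
    and deficiency: "deficiency_indices q a = (1, 1)"
    and phi1: "\<And>z. solves q a z (\<phi>1 z) \<and> \<phi>1 z a = 0 \<and> D1 a (\<phi>1 z) a = 1"
    and phi2: "\<And>z. solves q a z (\<phi>2 z) \<and> \<phi>2 z a = - 1 \<and> D1 a (\<phi>2 z) a = 0"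
    and weyl: "\<And>z. z \<notin> \<real>\<^sub>\<ge>\<^sub>0 \<Longrightarrow> (\<lambda>x. \<phi>2 z x + M z * \<phi>1 z x) \<in> L2 a"
    and nonneg: "nonnegative a (Dmin q a) (schr q a)"
    and m: "((\<lambda>t. M (complex_of_real t)) \<longlongrightarrow> complex_of_real m) (at_left 0)"
    and A: "A = Re (M \<i>)"
    and B: "B = - Im (M \<i>)"
    and ne: "Re (M \<i>) \<noteq> m"
  shows "\<forall>\<mu> h. Im h > 0 \<longrightarrow>
           (((\<mu>, h) \<in> extremal_systems q a \<and> c_entropy q a \<mu> h < \<infinity> \<and>
             (\<forall>(\<mu>', h') \<in> extremal_systems q a. c_entropy q a \<mu>' h' \<le> c_entropy q a \<mu> h))
            \<longleftrightarrow> h = - complex_of_real m + \<i> * complex_of_real (sqrt ((A - m)\<^sup>2 + B\<^sup>2)))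
         \<and> (h = - complex_of_real m + \<i> * complex_of_real (sqrt ((A - m)\<^sup>2 + B\<^sup>2)) \<longrightarrow>
              c_entropy q a \<mu> h =
                ereal (- (1 / 2) * ln ((sqrt (A\<^sup>2 + B\<^sup>2 - 2 * m * A + m\<^sup>2) - B) /
                                       (sqrt (A\<^sup>2 + B\<^sup>2 - 2 * m * A + m\<^sup>2) + B))))"
proof -
  define \<psi> where "\<psi> = (\<lambda>z. halfline a (\<lambda>x. \<phi>2 z x + M z * \<phi>1 z x))"
  have nonreal: "z \<notin> \<real>\<^sub>\<ge>\<^sub>0" if "Im z \<noteq> 0 \<or> Re z < 0" for z :: complex
    using that by (auto simp: complex_nonneg_Reals_iff)
  have sol: "solves q a z (\<lambda>x. \<phi>2 z x + M z * \<phi>1 z x)"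
    "\<phi>2 z a + M z * \<phi>1 z a = - 1" "D1 a (\<lambda>x. \<phi>2 z x + M z * \<phi>1 z x) a = M z" for z
  proof -
    show "solves q a z (\<lambda>x. \<phi>2 z x + M z * \<phi>1 z x)"
      using solves_lincomb[of q a z "\<phi>2 z" "\<phi>1 z" 1 "M z"] phi1 phi2 by simp
    show "\<phi>2 z a + M z * \<phi>1 z a = - 1" using phi1 phi2 by simp
    show "D1 a (\<lambda>x. \<phi>2 z x + M z * \<phi>1 z x) a = M z"
      using regular_lincomb(2)[of a "\<phi>2 z" "\<phi>1 z" a 1 "M z"] phi1 phi2 by (simp add: solves_def)
  qed
  have W: "weyl_solution q a z (M z) (\<psi> z)" if "z \<notin> \<real>\<^sub>\<ge>\<^sub>0" for z
    using solves_halfline[OF sol(1) weyl[OF that]] sol by (auto simp: weyl_solution_def \<psi>_def)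
  have i: "\<i> \<notin> \<real>\<^sub>\<ge>\<^sub>0" "- \<i> \<notin> \<real>\<^sub>\<ge>\<^sub>0" by (rule nonreal, simp)+
  have nL: "\<phi>1 z \<notin> L2 a" if "defect q a z = 1" "z \<notin> \<real>\<^sub>\<ge>\<^sub>0" for z
    by (rule defect_one_not_L2[OF that(1) _ _ _ sol(1,2) weyl[OF that(2)]]) (use phi1 in auto)
  have lp: "limit_point q a"
    by (rule limit_pointI[of q a "\<phi>1 \<i>" "\<phi>1 (- \<i>)"])
      (use phi1 nL i deficiency in \<open>auto simp: deficiency_indices_def\<close>)
  have Mi: "M (- \<i>) = cnj (M \<i>)"
    using weyl_function_cnj[OF lp W[OF i(1)], of "M (- \<i>)" "\<psi> (- \<i>)"] W[OF i(2)] by simp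
  have Bpos: "B > 0"
    using weyl_function_Im[OF lp W[OF i(1)]] weyl_solution_norm_pos[OF W[OF i(1)]] by (simp add: B)
  define d where "d = A - m"
  define s where "s = sqrt (d\<^sup>2 + B\<^sup>2)"
  define R where "R = (\<lambda>v. (d\<^sup>2 + (v - B)\<^sup>2) / (d\<^sup>2 + (v + B)\<^sup>2))"
  have d0: "d \<noteq> 0" using ne by (simp add: d_def A)
  have d2: "d\<^sup>2 > 0" using d0 by simp
  note min = entropy_ratio_min[OF d0 Bpos, folded s_def]
  have min1: "(s - B) / (s + B) \<le> R v" "(s - B) / (s + B) = R v \<longleftrightarrow> v = s" if "v > 0" for v
    using min(1,2)[OF that] by (simp_all add: R_def)
  have sB: "B < s" "0 < (s - B) / (s + B)" using min(3,4)[OF Bpos] by auto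
  have s0: "s > 0" using sB Bpos by simp
  have Rs: "R s = (s - B) / (s + B)" using min1(2)[OF s0] by simp
  have ext: "(\<mu>, h) \<in> extremal_systems q a \<longleftrightarrow> Im h > 0 \<and> Re h = - m" for \<mu> h
    unfolding extremal_systems_def
    using extremal_accretive_iff[OF lp, of "\<phi>1 0" "\<lambda>t. M (complex_of_real t)" "\<lambda>t. \<psi> (complex_of_real t)" m h]
      phi1 nonneg W nonreal m by auto
  have ent: "c_entropy q a \<mu> h = ereal (- (1/2) * ln (R (Im h)))" if h: "Im h > 0" "Re h = - m" for \<mu> h
  proof -
    \<comment> \<open>The only parameter with infinite entropy is \<open>- M(\<i>)\<close>, which lies off the line \<open>Re h = - m\<close> because \<open>A \<noteq> m\<close>.\<close>
    have hm: "h \<noteq> - M \<i>" using h d0 by (auto simp: d_def A)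
    have sq: "(cmod (M \<i> + h))\<^sup>2 = d\<^sup>2 + (Im h - B)\<^sup>2" "(cmod (M \<i> + cnj h))\<^sup>2 = d\<^sup>2 + (Im h + B)\<^sup>2"
      unfolding cmod_power2 by (simp_all add: d_def A B h power2_eq_square algebra_simps)
    have nz: "cmod (M \<i> + h) > 0" "cmod (M \<i> + cnj h) > 0"
      using sq d2 by (smt (verit) norm_ge_zero zero_le_power2 power_zero_numeral zero_less_norm_iff norm_zero)+
    have "ln (R (Im h)) = ln ((cmod (M \<i> + h) / cmod (M \<i> + cnj h))\<^sup>2)"
      by (simp add: R_def sq power_divide)
    also have "\<dots> = 2 * ln (cmod (M \<i> + h) / cmod (M \<i> + cnj h))"
      using nz by (simp add: ln_realpow)
    finally show ?thesis
      using c_entropy_eq[OF lp W[OF i(2), unfolded Mi] h(1), of \<mu>] hm by simp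
  qed
  have Rpos: "R v > 0" for v
    unfolding R_def using d2 by (intro divide_pos_pos add_pos_nonneg) auto
  have hs: "h = - complex_of_real m + \<i> * complex_of_real s \<longleftrightarrow> Re h = - m \<and> Im h = s" for h
    by (auto simp: complex_eq_iff)
  have ss: "sqrt ((A - m)\<^sup>2 + B\<^sup>2) = s" "sqrt (A\<^sup>2 + B\<^sup>2 - 2 * m * A + m\<^sup>2) = s"
    by (simp_all add: s_def d_def power2_eq_square algebra_simps)
  have le: "c_entropy q a \<mu>' h' \<le> c_entropy q a \<mu> h \<longleftrightarrow> R (Im h) \<le> R (Im h')"
    if "Im h > 0" "Re h = - m" "Im h' > 0" "Re h' = - m" for h h' \<mu> \<mu>'
    unfolding ent[OF that(1,2)] ent[OF that(3,4)] using Rpos by simp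
  show ?thesis
    unfolding ss
  proof (intro allI impI conjI iffI)
    fix \<mu> h
    assume h: "Im h > 0"
    {
      assume max: "(\<mu>, h) \<in> extremal_systems q a \<and> c_entropy q a \<mu> h < \<infinity> \<and>
        (\<forall>(\<mu>', h')\<in>extremal_systems q a. c_entropy q a \<mu>' h' \<le> c_entropy q a \<mu> h)"
      define h' where "h' = Complex (- m) s"
      have "Re h = - m" using max ext by blast
      moreover have "(\<mu>, h') \<in> extremal_systems q a" using ext s0 by (simp add: h'_def)
      then have "c_entropy q a \<mu> h' \<le> c_entropy q a \<mu> h" using max by blast
      ultimately have "R (Im h) \<le> R s" using le[OF h, of h'] s0 by (simp add: h'_def)
      then have "Im h = s" using min1[OF h] Rs by simp
      then show "h = - complex_of_real m + \<i> * complex_of_real s" using \<open>Re h = - m\<close> hs by blast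
    next
      assume "h = - complex_of_real m + \<i> * complex_of_real s"
      then have hr: "Re h = - m" "Im h = s" using hs by blast+
      show "(\<mu>, h) \<in> extremal_systems q a" using ext hr h by blast
      show "c_entropy q a \<mu> h < \<infinity>" using ent[OF h hr(1)] by simp
      show "\<forall>(\<mu>', h')\<in>extremal_systems q a. c_entropy q a \<mu>' h' \<le> c_entropy q a \<mu> h"
        using le[OF h hr(1)] ext min1(1) Rs hr(2) by auto
      show "c_entropy q a \<mu> h = ereal (- (1 / 2) * ln ((s - B) / (s + B)))"
        using ent[OF h hr(1)] hr(2) Rs by simp
    }
  qed
qed

end
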